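(* Let $I_k=[k,k+1)$ for $k\in\mathbb{Z}$, and view $\mathcal{H}=L^2(\mathbb{R})=\bigoplus_{k\in\mathbb{Z}}L^2(I_k)$ as the direct integral $\int_{\mathbb{Z}}^\oplus\mathcal{H}^k\,d\mu(k)$ with $\mathcal{H}^k=L^2(I_k,dx)$ over $(\mathbb{Z},\mathcal{P}(\mathbb{Z}),\mu)$, $\mu$ the counting measure. Let $\mathcal{D}$ be the dense subspace of piecewise continuous functions with compact support and let $$Q(\Phi,\Psi)=\int_{\mathbb{R}}x\,\overline{\Phi(x)}\,\Psi(x)\,dx,\qquad \Phi,\Psi\in\mathcal{D}.$$ Let $T$ be the self-adjoint multiplication operator $(T\Phi)(x)=x\,\Phi(x)$ with domain $\mathcal{D}(T)=\{\Phi\in\mathcal{H}\mid\int_{\mathbb{R}}x^2|\Phi(x)|^2\,dx<\infty\}$. Then $\mathcal{D}\subset\mathcal{D}(|T|^{1/2})$ and the following hold: (H1) $Q$ is closable and orthogonally additive; (H2) $\mu$ is point supported and $\mu(\{k\})>0$ for every $k\in\mathbb{Z}$; (H3) for every $k\in\mathbb{Z}$ the quadratic form $q_k$ on $P_k\mathcal{D}\subset\mathcal{H}^k$ is strongly representable by a self-adjoint operator on $\mathcal{H}^k$. Moreover, $Q$ is strongly representable by $T$.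
   Context: A function on $\mathbb{R}$ is piecewise continuous if it has only finitely many discontinuities on each compact interval, with finite one-sided limits at each of them (so a piecewise continuous function with compact support is bounded). Quadratic forms. A Hermitian quadratic form is the diagonal $Q(\Phi):=Q(\Phi,\Phi)$ of a Hermitian sesquilinear form (antilinear in the first entry). It is closable if for every sequence $\{\Phi_n\}\subset\mathcal{D}$ with $\Phi_n\to0$ in $\mathcal{H}$ and $\lim_{n,m\to\infty}Q(\Phi_n-\Phi_m)=0$ one has $\lim_nQ(\Phi_n)=0$. A form $\widehat Q$ on $\widehat{\mathcal{D}}$ extends $(Q,\mathcal{D})$ if $\mathcal{D}\subset\widehat{\mathcal{D}}\subset\mathcal{H}$ and $\widehat Q|_{\mathcal{D}}=Q$. Strong representability. Let $T$ be self-adjoint with resolution of the identity $E(\cdot)$ and $\nu_\Phi(\sigma)=\|E(\sigma)\Phi\|^2$. The spectral norm is $|||\Phi|||_E^2=\int_{\mathbb{R}}(1+|\lambda|)\,d\nu_\Phi(\lambda)$, $\Phi\in\mathcal{D}(|T|^{1/2})$. A Hermitian quadratic form $(Q,\mathcal{D})$ is strongly representable by $T$ if (1) there is an extension $(\widehat Q,\widehat{\mathcal{D}})$ of $(Q,\mathcal{D})$ with $\mathcal{D}(T)\subset\widehat{\mathcal{D}}$, and $\mathcal{D}\subset\mathcal{D}(|T|^{1/2})$; (2) $\widehat{\mathcal{D}}$ is the closure of $\mathcal{D}$ (in $\mathcal{D}(|T|^{1/2})$) with respect to $|||\cdot|||_E$; (3) $\widehat Q(\Phi)=\int_{\mathbb{R}}\lambda\,d\nu_\Phi(\lambda)$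 for all $\Phi\in\widehat{\mathcal{D}}$. For $\Delta\subset\mathbb{Z}$, $P_\Delta$ is the orthogonal projection onto $\bigoplus_{k\in\Delta}L^2(I_k)$, i.e. multiplication by the indicator function of $\bigcup_{k\in\Delta}I_k$; $P_k:=P_{\{k\}}$. $(Q,\mathcal{D})$ is orthogonally additive if: (i) $P_\Delta\mathcal{D}\subset\mathcal{D}$ for all $\Delta\subset\mathbb{Z}$; (ii) for each $\Phi\in\mathcal{D}$ there is $M_\Phi>0$ with $|Q(P_\Delta\Phi)|<M_\Phi$ for all $\Delta\subset\mathbb{Z}$; (iii) for each finite partition $\{\Delta_i\}_{i=1}^N$ of a $\Delta\subset\mathbb{Z}$ and each $\Phi\in\mathcal{D}$, $Q(P_\Delta\Phi)=\sum_{i=1}^NQ(P_{\Delta_i}\Phi)$. A measure $\mu$ on a countable set $\mathcal{A}$ is point supported if all subsets are measurable and $\mu(\Delta)=\sum_{x\in\Delta}\mu(\{x\})$ for all $\Delta\subset\mathcal{A}$. $q_k$ is the quadratic form on $P_k\mathcal{D}\subset L^2(I_k)$ given by $q_k(P_k\Phi)=Q(P_k\Phi)=\int_{I_k}x|\Phi(x)|^2\,dx$. *)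

theory Defs
  imports "HOL-Analysis.Analysis"
begin

section \<open>Complex Hilbert spaces\<close>

text \<open>The real structure (norm, topology, real inner product) is the one of the library class
  \<^class>\<open>real_inner\<close>; the real inner product is the real part of the complex one. The complex
  inner product is antilinear in its first argument.\<close>

class complex_inner = real_inner +
  fixes scaleC :: "complex \<Rightarrow> 'a \<Rightarrow> 'a" (infixr "*\<^sub>C" 75)
    and cinner :: "'a \<Rightarrow> 'a \<Rightarrow> complex"
  assumes scaleC_add_right: "c *\<^sub>C (x + y) = c *\<^sub>C x + c *\<^sub>C y"
    and scaleC_add_left: "(c + d) *\<^sub>C x = c *\<^sub>C x + d *\<^sub>C x"
    and scaleC_scaleC: "c *\<^sub>C d *\<^sub>C x = (c * d) *\<^sub>C x"
    and scaleR_scaleC: "r *\<^sub>R x = complex_of_real r *\<^sub>C x"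
    and cinner_commute: "cinner x y = cnj (cinner y x)"
    and cinner_add_right: "cinner x (y + z) = cinner x y + cinner x z"
    and cinner_scaleC_right: "cinner x (c *\<^sub>C y) = c * cinner x y"
    and inner_eq_Re_cinner: "inner x y = Re (cinner x y)"

class complex_hilbert = complex_inner + complete_space

section \<open>Operators and quadratic forms on a closed subspace\<close>

text \<open>Throughout, \<^term>\<open>H\<close> is a closed complex subspace of a Hilbert space, regarded as a Hilbert
  space of its own (\<^term>\<open>H = UNIV\<close> for the whole space). An operator is given by a domain
  \<^term>\<open>DT\<close> and a function \<^term>\<open>T\<close> of which only the values on \<^term>\<open>DT\<close> matter; likewise for
  forms.\<close>

definition csubspace :: "'a::complex_inner set \<Rightarrow> bool" where
  "csubspace S \<longleftrightarrow> 0 \<in> S \<and> (\<forall>x\<in>S. \<forall>y\<in>S. x + y \<in> S) \<and> (\<forall>c. \<forall>x\<in>S. c *\<^sub>C x \<in> S)"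

definition clinear_on :: "'a::complex_inner set \<Rightarrow> ('a \<Rightarrow> 'b::complex_inner) \<Rightarrow> bool" where
  "clinear_on S f \<longleftrightarrow>
    (\<forall>x\<in>S. \<forall>y\<in>S. f (x + y) = f x + f y) \<and> (\<forall>c. \<forall>x\<in>S. f (c *\<^sub>C x) = c *\<^sub>C f x)"

definition adjoint_graph :: "'a::complex_hilbert set \<Rightarrow> 'a set \<Rightarrow> ('a \<Rightarrow> 'a) \<Rightarrow> ('a \<times> 'a) set" where
  "adjoint_graph H DT T =
    {(\<Psi>, \<eta>). \<Psi> \<in> H \<and> \<eta> \<in> H \<and> (\<forall>\<Phi>\<in>DT. cinner \<Psi> (T \<Phi>) = cinner \<eta> \<Phi>)}"

definition selfadjoint :: "'a::complex_hilbert set \<Rightarrow> 'a set \<Rightarrow> ('a \<Rightarrow> 'a) \<Rightarrow> bool" where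
  "selfadjoint H DT T \<longleftrightarrow>
    csubspace DT \<and> DT \<subseteq> H \<and> H \<subseteq> closure DT \<and> T ` DT \<subseteq> H \<and> clinear_on DT T \<and>
    adjoint_graph H DT T = (\<lambda>\<Phi>. (\<Phi>, T \<Phi>)) ` DT"

definition orthogonal_projection :: "'a::complex_hilbert set \<Rightarrow> ('a \<Rightarrow> 'a) \<Rightarrow> bool" where
  "orthogonal_projection H p \<longleftrightarrow>
    p ` H \<subseteq> H \<and> clinear_on H p \<and> (\<forall>\<Phi>\<in>H. p (p \<Phi>) = p \<Phi>) \<and>
    (\<forall>\<Phi>\<in>H. \<forall>\<Psi>\<in>H. cinner (p \<Phi>) \<Psi> = cinner \<Phi> (p \<Psi>))"

text \<open>A resolution of the identity is a projection-valued measure on the Borel sets of the line.\<close>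

definition resolution_of_identity :: "'a::complex_hilbert set \<Rightarrow> (real set \<Rightarrow> 'a \<Rightarrow> 'a) \<Rightarrow> bool" where
  "resolution_of_identity H E \<longleftrightarrow>
    (\<forall>\<sigma>\<in>sets borel. orthogonal_projection H (E \<sigma>)) \<and>
    (\<forall>\<Phi>\<in>H. E {} \<Phi> = 0 \<and> E UNIV \<Phi> = \<Phi>) \<and>
    (\<forall>\<sigma>\<in>sets borel. \<forall>\<tau>\<in>sets borel. \<forall>\<Phi>\<in>H. E (\<sigma> \<inter> \<tau>) \<Phi> = E \<sigma> (E \<tau> \<Phi>)) \<and>
    (\<forall>\<sigma> :: nat \<Rightarrow> real set. range \<sigma> \<subseteq> sets borel \<longrightarrow> disjoint_family \<sigma> \<longrightarrow>
      (\<forall>\<Phi>\<in>H. (\<lambda>n. E (\<sigma> n) \<Phi>) sums E (\<Union>n. \<sigma> n) \<Phi>))"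

definition spectral_measure :: "(real set \<Rightarrow> 'a::complex_hilbert \<Rightarrow> 'a) \<Rightarrow> 'a \<Rightarrow> real measure" where
  "spectral_measure E \<Phi> = measure_of UNIV (sets borel) (\<lambda>\<sigma>. ennreal ((norm (E \<sigma> \<Phi>))\<^sup>2))"

text \<open>\<^term>\<open>E\<close> is the resolution of the identity of \<^term>\<open>T\<close>, i.e. $T = \int \lambda\,dE(\lambda)$ with its natural
  domain. By polarization the diagonal matrix elements determine \<^term>\<open>T\<close>. On Borel
  sets and on \<^term>\<open>H\<close>, such an \<^term>\<open>E\<close> is unique, so that \<open>\<exists>E\<close> below names the resolution of
  the identity of \<^term>\<open>T\<close>.\<close>

definition is_resolution_of ::
  "'a::complex_hilbert set \<Rightarrow> 'a set \<Rightarrow> ('a \<Rightarrow> 'a) \<Rightarrow> (real set \<Rightarrow> 'a \<Rightarrow> 'a) \<Rightarrow> bool" where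
  "is_resolution_of H DT T E \<longleftrightarrow>
    resolution_of_identity H E \<and>
    DT = {\<Phi>\<in>H. integrable (spectral_measure E \<Phi>) (\<lambda>l. l\<^sup>2)} \<and>
    (\<forall>\<Phi>\<in>DT. cinner \<Phi> (T \<Phi>) = complex_of_real (LINT l|spectral_measure E \<Phi>. l))"

text \<open>The domain of $|T|^{1/2} = \int |\lambda|^{1/2}\,dE(\lambda)$, in terms of \<^term>\<open>E\<close> and of \<^term>\<open>T\<close>.\<close>

definition spectral_form_domain :: "'a::complex_hilbert set \<Rightarrow> (real set \<Rightarrow> 'a \<Rightarrow> 'a) \<Rightarrow> 'a set" where
  "spectral_form_domain H E = {\<Phi>\<in>H. integrable (spectral_measure E \<Phi>) (\<lambda>l. \<bar>l\<bar>)}"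

definition sqrt_abs_domain :: "'a::complex_hilbert set \<Rightarrow> 'a set \<Rightarrow> ('a \<Rightarrow> 'a) \<Rightarrow> 'a set" where
  "sqrt_abs_domain H DT T = {\<Phi>. \<exists>E. is_resolution_of H DT T E \<and> \<Phi> \<in> spectral_form_domain H E}"

text \<open>Only meaningful on \<^const>\<open>spectral_form_domain\<close>, where the integrand is integrable.\<close>

definition spectral_norm :: "(real set \<Rightarrow> 'a::complex_hilbert \<Rightarrow> 'a) \<Rightarrow> 'a \<Rightarrow> real" where
  "spectral_norm E \<Phi> = sqrt (LINT l|spectral_measure E \<Phi>. 1 + \<bar>l\<bar>)"

definition hermitian_form :: "'a::complex_inner set \<Rightarrow> ('a \<Rightarrow> 'a \<Rightarrow> complex) \<Rightarrow> bool" where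
  "hermitian_form D B \<longleftrightarrow>
    csubspace D \<and>
    (\<forall>\<Phi>\<in>D. \<forall>\<Psi>\<in>D. \<forall>\<Xi>\<in>D. B \<Phi> (\<Psi> + \<Xi>) = B \<Phi> \<Psi> + B \<Phi> \<Xi> \<and> B (\<Phi> + \<Psi>) \<Xi> = B \<Phi> \<Xi> + B \<Psi> \<Xi>) \<and>
    (\<forall>c. \<forall>\<Phi>\<in>D. \<forall>\<Psi>\<in>D. B \<Phi> (c *\<^sub>C \<Psi>) = c * B \<Phi> \<Psi> \<and> B (c *\<^sub>C \<Phi>) \<Psi> = cnj c * B \<Phi> \<Psi>) \<and>
    (\<forall>\<Phi>\<in>D. \<forall>\<Psi>\<in>D. B \<Psi> \<Phi> = cnj (B \<Phi> \<Psi>))"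

definition hermitian_quadratic_form :: "'a::complex_inner set \<Rightarrow> ('a \<Rightarrow> complex) \<Rightarrow> bool" where
  "hermitian_quadratic_form D q \<longleftrightarrow> (\<exists>B. hermitian_form D B \<and> (\<forall>\<Phi>\<in>D. q \<Phi> = B \<Phi> \<Phi>))"

definition closable :: "'a::complex_inner set \<Rightarrow> ('a \<Rightarrow> complex) \<Rightarrow> bool" where
  "closable D q \<longleftrightarrow>
    (\<forall>\<Phi> :: nat \<Rightarrow> 'a. range \<Phi> \<subseteq> D \<longrightarrow> \<Phi> \<longlonglongrightarrow> 0 \<longrightarrow>
      ((\<lambda>(n, m). q (\<Phi> n - \<Phi> m)) \<longlongrightarrow> 0) (sequentially \<times>\<^sub>F sequentially) \<longrightarrow>
      (\<lambda>n. q (\<Phi> n)) \<longlonglongrightarrow> 0)"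

definition form_extends ::
  "'a::complex_inner set \<Rightarrow> 'a set \<Rightarrow> ('a \<Rightarrow> complex) \<Rightarrow> 'a set \<Rightarrow> ('a \<Rightarrow> complex) \<Rightarrow> bool" where
  "form_extends H D' q' D q \<longleftrightarrow>
    hermitian_quadratic_form D' q' \<and> D \<subseteq> D' \<and> D' \<subseteq> H \<and> (\<forall>\<Phi>\<in>D. q' \<Phi> = q \<Phi>)"

definition strongly_representable ::
  "'a::complex_hilbert set \<Rightarrow> 'a set \<Rightarrow> ('a \<Rightarrow> complex) \<Rightarrow> 'a set \<Rightarrow> ('a \<Rightarrow> 'a) \<Rightarrow> bool" where
  "strongly_representable H D q DT T \<longleftrightarrow>
    hermitian_quadratic_form D q \<and> selfadjoint H DT T \<and>
    (\<exists>E. is_resolution_of H DT T E \<and>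
      (\<exists>D' q'. form_extends H D' q' D q \<and> DT \<subseteq> D' \<and> D \<subseteq> spectral_form_domain H E \<and>
        D' = {\<Phi> \<in> spectral_form_domain H E. \<forall>\<epsilon>>0. \<exists>\<Psi>\<in>D. spectral_norm E (\<Phi> - \<Psi>) < \<epsilon>} \<and>
        (\<forall>\<Phi>\<in>D'. q' \<Phi> = complex_of_real (LINT l|spectral_measure E \<Phi>. l))))"

text \<open>Here \<^term>\<open>P \<Delta>\<close> is a projection for every set \<^term>\<open>\<Delta>\<close> of indices.\<close>

definition orthogonally_additive ::
  "('k set \<Rightarrow> 'a \<Rightarrow> 'a) \<Rightarrow> 'a::complex_inner set \<Rightarrow> ('a \<Rightarrow> complex) \<Rightarrow> bool" where
  "orthogonally_additive P D q \<longleftrightarrow>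
    (\<forall>\<Delta>. P \<Delta> ` D \<subseteq> D) \<and>
    (\<forall>\<Phi>\<in>D. \<exists>M>0. \<forall>\<Delta>. cmod (q (P \<Delta> \<Phi>)) < M) \<and>
    (\<forall>\<Delta> \<P>. finite \<P> \<longrightarrow> partition_on \<Delta> \<P> \<longrightarrow>
      (\<forall>\<Phi>\<in>D. q (P \<Delta> \<Phi>) = (\<Sum>\<Gamma>\<in>\<P>. q (P \<Gamma> \<Phi>))))"

section \<open>Direct integrals over discrete measure spaces\<close>

text \<open>Over a measure space in which all subsets are measurable and no nonempty set is null, every
  section is measurable and sections need not be identified almost everywhere. The direct integral
  of the spaces \<^term>\<open>Hf k\<close> then consists of the square-integrable sections, with inner product
  $\int \langle\varphi(k),\psi(k)\rangle\,d\mu(k)$.\<close>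

definition discrete_direct_integral ::
  "'k measure \<Rightarrow> ('k \<Rightarrow> 'a::complex_hilbert set) \<Rightarrow> ('k \<Rightarrow> 'a) set" where
  "discrete_direct_integral \<mu> Hf =
    {\<phi> \<in> PiE (space \<mu>) Hf. integrable \<mu> (\<lambda>k. (norm (\<phi> k))\<^sup>2)}"

text \<open>The map \<^term>\<open>U\<close> is a unitary from the whole space onto the direct integral.\<close>

definition direct_integral_unitary ::
  "'k measure \<Rightarrow> ('k \<Rightarrow> 'a::complex_hilbert set) \<Rightarrow> ('a \<Rightarrow> 'k \<Rightarrow> 'a) \<Rightarrow> bool" where
  "direct_integral_unitary \<mu> Hf U \<longleftrightarrow>
    bij_betw U UNIV (discrete_direct_integral \<mu> Hf) \<and>
    (\<forall>k\<in>space \<mu>. clinear_on UNIV (\<lambda>\<Phi>. U \<Phi> k)) \<and>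
    (\<forall>\<Phi> \<Psi>. cinner \<Phi> \<Psi> = (LINT k|\<mu>. cinner (U \<Phi> k) (U \<Psi> k)))"

definition point_supported :: "'k measure \<Rightarrow> bool" where
  "point_supported \<mu> \<longleftrightarrow>
    countable (space \<mu>) \<and> sets \<mu> = Pow (space \<mu>) \<and>
    (\<forall>\<Delta>\<subseteq>space \<mu>. emeasure \<mu> \<Delta> = (\<Sum>\<^sub>\<infinity>x\<in>\<Delta>. emeasure \<mu> {x}))"

section \<open>The Hilbert space of square-integrable functions on the real line\<close>

definition sq_integrable :: "(real \<Rightarrow> complex) \<Rightarrow> bool" where
  "sq_integrable f \<longleftrightarrow> f \<in> borel_measurable lborel \<and> integrable lborel (\<lambda>x. (cmod (f x))\<^sup>2)"

lemma sq_integrableD [dest]: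
  assumes "sq_integrable f"
  shows "f \<in> borel_measurable borel" "integrable lborel (\<lambda>x. (cmod (f x))\<^sup>2)"
  using assms by (auto simp: sq_integrable_def)

lemma sq_integrable_zero: "sq_integrable (\<lambda>x. 0)"
  by (simp add: sq_integrable_def)

lemma sq_integrable_dominated:
  assumes "sq_integrable f" "g \<in> borel_measurable borel" "AE x in lborel. cmod (g x) \<le> cmod (f x)"
  shows "sq_integrable g"
proof -
  have "integrable lborel (\<lambda>x. (cmod (g x))\<^sup>2)"
  proof (rule Bochner_Integration.integrable_bound)
    show "integrable lborel (\<lambda>x. (cmod (f x))\<^sup>2)" using assms(1) by auto
    show "(\<lambda>x. (cmod (g x))\<^sup>2) \<in> borel_measurable lborel" using assms(2) by simp
    show "AE x in lborel. norm ((cmod (g x))\<^sup>2) \<le> norm ((cmod (f x))\<^sup>2)"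
      using assms(3) by eventually_elim (auto intro!: power_mono)
  qed
  thus ?thesis using assms(2) by (simp add: sq_integrable_def)
qed

lemma sq_integrable_add:
  assumes "sq_integrable f" "sq_integrable g"
  shows "sq_integrable (\<lambda>x. f x + g x)"
proof -
  have m: "f \<in> borel_measurable borel" "g \<in> borel_measurable borel" using assms by auto
  have "integrable lborel (\<lambda>x. (cmod (f x + g x))\<^sup>2)"
  proof (rule Bochner_Integration.integrable_bound)
    show "integrable lborel (\<lambda>x. 2 * (cmod (f x))\<^sup>2 + 2 * (cmod (g x))\<^sup>2)"
      using sq_integrableD(2)[OF assms(1)] sq_integrableD(2)[OF assms(2)] by simp
    show "(\<lambda>x. (cmod (f x + g x))\<^sup>2) \<in> borel_measurable lborel" using m by simp
    have "(cmod (a + b))\<^sup>2 \<le> 2 * (cmod a)\<^sup>2 + 2 * (cmod b)\<^sup>2" for a b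
    proof -
      have "(cmod (a + b))\<^sup>2 \<le> (cmod a + cmod b)\<^sup>2"
        by (intro power_mono norm_triangle_ineq) auto
      also have "\<dots> \<le> 2 * (cmod a)\<^sup>2 + 2 * (cmod b)\<^sup>2"
        using sum_squares_bound[of "cmod a" "cmod b"] by (simp add: power2_sum)
      finally show ?thesis .
    qed
    thus "AE x in lborel. norm ((cmod (f x + g x))\<^sup>2) \<le> norm (2 * (cmod (f x))\<^sup>2 + 2 * (cmod (g x))\<^sup>2)"
      by simp
  qed
  thus ?thesis using m by (simp add: sq_integrable_def)
qed

lemma sq_integrable_scale:
  assumes "sq_integrable f"
  shows "sq_integrable (\<lambda>x. c * f x)"
  using assms by (auto simp: sq_integrable_def norm_mult power_mult_distrib)

lemma sq_integrable_minus:
  assumes "sq_integrable f" "sq_integrable g"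
  shows "sq_integrable (\<lambda>x. f x - g x)"
  using sq_integrable_add[OF assms(1) sq_integrable_scale[OF assms(2), of "-1"]] by simp

lemma sq_integrable_uminus:
  assumes "sq_integrable f"
  shows "sq_integrable (\<lambda>x. - f x)"
  using sq_integrable_scale[OF assms, of "-1"] by simp

lemma sq_integrable_prod:
  assumes "sq_integrable f" "sq_integrable g"
  shows "integrable lborel (\<lambda>x. cnj (f x) * g x)"
proof (rule Bochner_Integration.integrable_bound)
  have m: "f \<in> borel_measurable borel" "g \<in> borel_measurable borel" using assms by auto
  show "integrable lborel (\<lambda>x. (cmod (f x))\<^sup>2 + (cmod (g x))\<^sup>2)" using assms by auto
  show "(\<lambda>x. cnj (f x) * g x) \<in> borel_measurable lborel"
    using m borel_measurable_continuous_on[OF continuous_on_cnj[OF continuous_on_id] m(1)] by simp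
  have "cmod a * cmod b \<le> (cmod a)\<^sup>2 + (cmod b)\<^sup>2" for a b
  proof -
    have "2 * (cmod a * cmod b) \<le> (cmod a)\<^sup>2 + (cmod b)\<^sup>2" 
      using sum_squares_bound[of "cmod a" "cmod b"] by (simp add: mult.assoc)
    moreover have "0 \<le> cmod a * cmod b" by simp
    ultimately show ?thesis by linarith
  qed
  thus "AE x in lborel. norm (cnj (f x) * g x) \<le> norm ((cmod (f x))\<^sup>2 + (cmod (g x))\<^sup>2)"
    by (auto simp: norm_mult)
qed

definition l2_eq :: "(real \<Rightarrow> complex) \<Rightarrow> (real \<Rightarrow> complex) \<Rightarrow> bool" where
  "l2_eq f g \<longleftrightarrow> sq_integrable f \<and> sq_integrable g \<and> (AE x in lborel. f x = g x)"

lemma part_equivp_l2_eq: "part_equivp l2_eq"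
proof (rule part_equivpI)
  show "\<exists>x. l2_eq x x" using sq_integrable_zero by (auto simp: l2_eq_def)
  show "symp l2_eq" by (auto simp: symp_def l2_eq_def elim: eventually_mono)
  show "transp l2_eq"
    unfolding transp_def l2_eq_def by (auto elim: eventually_elim2)
qed

quotient_type L2 = "real \<Rightarrow> complex" / partial: l2_eq
  by (rule part_equivp_l2_eq)

text \<open>\<^term>\<open>rep_L2 \<Phi>\<close> is a chosen representative of the class \<^term>\<open>\<Phi>\<close> and
  \<^term>\<open>abs_L2 f\<close> the class of a square-integrable function \<^term>\<open>f\<close>.\<close>

lemma sq_integrable_rep [simp]: "sq_integrable (rep_L2 \<Phi>)"
  using Quotient3_rep_reflp[OF Quotient3_L2, of \<Phi>] by (simp add: l2_eq_def)

lemma rep_measurable [measurable, simp]: "rep_L2 \<Phi> \<in> borel_measurable borel"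
  using sq_integrable_rep by blast

lemma AE_rep_abs:
  assumes "sq_integrable f"
  shows "AE x in lborel. rep_L2 (abs_L2 f) x = f x"
  using rep_abs_rsp[OF Quotient3_L2, of f f] assms by (auto simp: l2_eq_def elim: eventually_mono)

lemma L2_eqI:
  assumes "AE x in lborel. rep_L2 \<Phi> x = rep_L2 \<Psi> x"
  shows "\<Phi> = \<Psi>"
  using Quotient3_rel_rep[OF Quotient3_L2, of \<Phi> \<Psi>] assms by (simp add: l2_eq_def)

lemma abs_L2_eqI:
  assumes "sq_integrable f" "sq_integrable g" "AE x in lborel. f x = g x"
  shows "abs_L2 f = abs_L2 g"
  using Quotient3_rel_abs[OF Quotient3_L2, of f g] assms by (simp add: l2_eq_def)

instantiation L2 :: complex_inner
begin

definition zero_L2 :: L2 where "zero_L2 = abs_L2 (\<lambda>x. 0)"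
definition plus_L2 :: "L2 \<Rightarrow> L2 \<Rightarrow> L2" where
  "plus_L2 \<Phi> \<Psi> = abs_L2 (\<lambda>x. rep_L2 \<Phi> x + rep_L2 \<Psi> x)"
definition minus_L2 :: "L2 \<Rightarrow> L2 \<Rightarrow> L2" where
  "minus_L2 \<Phi> \<Psi> = abs_L2 (\<lambda>x. rep_L2 \<Phi> x - rep_L2 \<Psi> x)"
definition uminus_L2 :: "L2 \<Rightarrow> L2" where "uminus_L2 \<Phi> = abs_L2 (\<lambda>x. - rep_L2 \<Phi> x)"
definition scaleC_L2 :: "complex \<Rightarrow> L2 \<Rightarrow> L2" where
  "scaleC_L2 c \<Phi> = abs_L2 (\<lambda>x. c * rep_L2 \<Phi> x)"
definition scaleR_L2 :: "real \<Rightarrow> L2 \<Rightarrow> L2" where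
  "scaleR_L2 r \<Phi> = complex_of_real r *\<^sub>C \<Phi>"
definition cinner_L2 :: "L2 \<Rightarrow> L2 \<Rightarrow> complex" where
  "cinner_L2 \<Phi> \<Psi> = (LINT x|lborel. cnj (rep_L2 \<Phi> x) * rep_L2 \<Psi> x)"
definition inner_L2 :: "L2 \<Rightarrow> L2 \<Rightarrow> real" where "inner_L2 \<Phi> \<Psi> = Re (cinner \<Phi> \<Psi>)"
definition norm_L2 :: "L2 \<Rightarrow> real" where "norm_L2 \<Phi> = sqrt (inner \<Phi> \<Phi>)"
definition dist_L2 :: "L2 \<Rightarrow> L2 \<Rightarrow> real" where "dist_L2 \<Phi> \<Psi> = norm (\<Phi> - \<Psi>)"
definition sgn_L2 :: "L2 \<Rightarrow> L2" where "sgn_L2 \<Phi> = inverse (norm \<Phi>) *\<^sub>R \<Phi>"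
definition uniformity_L2 :: "(L2 \<times> L2) filter" where
  "uniformity_L2 = (INF e\<in>{0 <..}. principal {(\<Phi>, \<Psi>). dist \<Phi> \<Psi> < e})"
definition open_L2 :: "L2 set \<Rightarrow> bool" where
  "open_L2 U \<longleftrightarrow> (\<forall>\<Phi>\<in>U. \<forall>\<^sub>F (\<Phi>', \<Psi>) in uniformity. \<Phi>' = \<Phi> \<longrightarrow> \<Psi> \<in> U)"

lemma AE_rep_zero: "AE x in lborel. rep_L2 0 x = 0"
  unfolding zero_L2_def by (intro AE_rep_abs sq_integrable_zero)

lemma AE_rep_add: "AE x in lborel. rep_L2 (\<Phi> + \<Psi>) x = rep_L2 \<Phi> x + rep_L2 \<Psi> x"
  unfolding plus_L2_def by (intro AE_rep_abs sq_integrable_add sq_integrable_rep)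

lemma AE_rep_minus: "AE x in lborel. rep_L2 (\<Phi> - \<Psi>) x = rep_L2 \<Phi> x - rep_L2 \<Psi> x"
  unfolding minus_L2_def by (intro AE_rep_abs sq_integrable_minus sq_integrable_rep)

lemma AE_rep_uminus: "AE x in lborel. rep_L2 (- \<Phi>) x = - rep_L2 \<Phi> x"
  unfolding uminus_L2_def by (intro AE_rep_abs sq_integrable_uminus sq_integrable_rep)

lemma AE_rep_scaleC: "AE x in lborel. rep_L2 (c *\<^sub>C \<Phi>) x = c * rep_L2 \<Phi> x"
  unfolding scaleC_L2_def by (intro AE_rep_abs sq_integrable_scale sq_integrable_rep)

lemma integrable_rep_prod: "integrable lborel (\<lambda>x. cnj (rep_L2 \<Phi> x) * rep_L2 \<Psi> x)"
  by (intro sq_integrable_prod sq_integrable_rep)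

lemma integrable_rep_sq: "integrable lborel (\<lambda>x. (cmod (rep_L2 \<Phi> x))\<^sup>2)"
  using sq_integrable_rep by blast

lemma cinner_L2_self: "cinner \<Phi> \<Phi> = complex_of_real (LINT x|lborel. (cmod (rep_L2 \<Phi> x))\<^sup>2)"
proof -
  have "cnj z * z = complex_of_real ((cmod z)\<^sup>2)" for z
    using complex_norm_square[of z] by (simp add: mult.commute)
  thus ?thesis by (simp only: cinner_L2_def integral_complex_of_real)
qed

lemma prod_measurable: "(\<lambda>x. cnj (rep_L2 \<Phi> x) * rep_L2 \<Psi> x) \<in> borel_measurable lborel"
  using integrable_rep_prod by auto

instance
proof
  fix \<Phi> \<Psi> \<Xi> :: L2 and c d :: complex and r s :: real
  show "\<Phi> + \<Psi> + \<Xi> = \<Phi> + (\<Psi> + \<Xi>)"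
    by (rule L2_eqI, use AE_rep_add[of "\<Phi> + \<Psi>" \<Xi>] AE_rep_add[of \<Phi> \<Psi>] AE_rep_add[of \<Phi> "\<Psi> + \<Xi>"] AE_rep_add[of \<Psi> \<Xi>] in eventually_elim, simp)
  show comm: "\<Phi> + \<Psi> = \<Psi> + \<Phi>" by (simp add: plus_L2_def add.commute)
  show "0 + \<Phi> = \<Phi>"
    by (rule L2_eqI, use AE_rep_add[of 0 \<Phi>] AE_rep_zero in eventually_elim, simp)
  show "- \<Phi> + \<Phi> = 0"
    by (rule L2_eqI, use AE_rep_add[of "-\<Phi>" \<Phi>] AE_rep_zero AE_rep_uminus[of \<Phi>] in eventually_elim, simp)
  show "\<Phi> - \<Psi> = \<Phi> + - \<Psi>"
    by (rule L2_eqI, use AE_rep_add[of \<Phi> "-\<Psi>"] AE_rep_minus[of \<Phi> \<Psi>] AE_rep_uminus[of \<Psi>] in eventually_elim, simp)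
  have C1: "c *\<^sub>C (\<Phi> + \<Psi>) = c *\<^sub>C \<Phi> + c *\<^sub>C \<Psi>" for c and \<Phi> \<Psi> :: L2
    by (rule L2_eqI, use AE_rep_scaleC[of c "\<Phi> + \<Psi>"] AE_rep_scaleC[of c \<Phi>] AE_rep_scaleC[of c \<Psi>]
      AE_rep_add[of \<Phi> \<Psi>] AE_rep_add[of "c *\<^sub>C \<Phi>" "c *\<^sub>C \<Psi>"] in eventually_elim, simp add: algebra_simps)
  have C2: "(c + d) *\<^sub>C \<Phi> = c *\<^sub>C \<Phi> + d *\<^sub>C \<Phi>" for c d and \<Phi> :: L2
    by (rule L2_eqI, use AE_rep_scaleC[of "c + d" \<Phi>] AE_rep_scaleC[of c \<Phi>] AE_rep_scaleC[of d \<Phi>]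
      AE_rep_add[of "c *\<^sub>C \<Phi>" "d *\<^sub>C \<Phi>"] in eventually_elim, simp add: algebra_simps)
  have C3: "c *\<^sub>C d *\<^sub>C \<Phi> = (c * d) *\<^sub>C \<Phi>" for c d and \<Phi> :: L2
    by (rule L2_eqI, use AE_rep_scaleC[of "c * d" \<Phi>] AE_rep_scaleC[of d \<Phi>] AE_rep_scaleC[of c "d *\<^sub>C \<Phi>"] in eventually_elim, simp)
  show "c *\<^sub>C (\<Phi> + \<Psi>) = c *\<^sub>C \<Phi> + c *\<^sub>C \<Psi>" by (rule C1)
  show "(c + d) *\<^sub>C \<Phi> = c *\<^sub>C \<Phi> + d *\<^sub>C \<Phi>" by (rule C2)
  show "c *\<^sub>C d *\<^sub>C \<Phi> = (c * d) *\<^sub>C \<Phi>" by (rule C3)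
  show "r *\<^sub>R \<Phi> = complex_of_real r *\<^sub>C \<Phi>" by (simp add: scaleR_L2_def)
  show "r *\<^sub>R (\<Phi> + \<Psi>) = r *\<^sub>R \<Phi> + r *\<^sub>R \<Psi>" by (simp add: scaleR_L2_def C1)
  show "(r + s) *\<^sub>R \<Phi> = r *\<^sub>R \<Phi> + s *\<^sub>R \<Phi>" by (simp add: scaleR_L2_def C2)
  show "r *\<^sub>R s *\<^sub>R \<Phi> = (r * s) *\<^sub>R \<Phi>" by (simp add: scaleR_L2_def C3)
  show "1 *\<^sub>R \<Phi> = \<Phi>"
    using AE_rep_scaleC[of 1 \<Phi>] by (intro L2_eqI) (simp add: scaleR_L2_def)
  show "sgn \<Phi> = inverse (norm \<Phi>) *\<^sub>R \<Phi>" by (rule sgn_L2_def)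
  show "dist \<Phi> \<Psi> = norm (\<Phi> - \<Psi>)" by (rule dist_L2_def)
  show "(uniformity :: (L2 \<times> L2) filter) = (INF e\<in>{0 <..}. principal {(\<Phi>, \<Psi>). dist \<Phi> \<Psi> < e})"
    by (rule uniformity_L2_def)
  show "open U = (\<forall>\<Phi>\<in>U. \<forall>\<^sub>F (\<Phi>', \<Psi>) in uniformity. \<Phi>' = \<Phi> \<longrightarrow> \<Psi> \<in> U)" for U :: "L2 set"
    by (rule open_L2_def)
  have com: "cinner \<Phi> \<Psi> = cnj (cinner \<Psi> \<Phi>)" for \<Phi> \<Psi> :: L2
  proof -
    have "cnj (cinner \<Psi> \<Phi>) = (LINT x|lborel. cnj (cnj (rep_L2 \<Psi> x) * rep_L2 \<Phi> x))"
      unfolding cinner_L2_def by (rule Bochner_Integration.integral_cnj [symmetric])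
    thus ?thesis by (simp add: cinner_L2_def mult.commute del: Bochner_Integration.integral_cnj)
  qed
  show "cinner \<Phi> \<Psi> = cnj (cinner \<Psi> \<Phi>)" by (rule com)
  have A: "cinner \<Phi> (\<Psi> + \<Xi>) = cinner \<Phi> \<Psi> + cinner \<Phi> \<Xi>" for \<Phi> \<Psi> \<Xi> :: L2
  proof -
    have "cinner \<Phi> (\<Psi> + \<Xi>)
        = (LINT x|lborel. cnj (rep_L2 \<Phi> x) * rep_L2 \<Psi> x + cnj (rep_L2 \<Phi> x) * rep_L2 \<Xi> x)"
      unfolding cinner_L2_def using AE_rep_add[of \<Psi> \<Xi>]
      by (intro integral_cong_AE borel_measurable_add prod_measurable)
         (auto simp: algebra_simps elim: eventually_mono)
    thus ?thesis by (simp add: cinner_L2_def integrable_rep_prod)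
  qed
  show "cinner \<Phi> (\<Psi> + \<Xi>) = cinner \<Phi> \<Psi> + cinner \<Phi> \<Xi>" by (rule A)
  have S: "cinner \<Phi> (c *\<^sub>C \<Psi>) = c * cinner \<Phi> \<Psi>" for c and \<Phi> \<Psi> :: L2
  proof -
    have "cinner \<Phi> (c *\<^sub>C \<Psi>) = (LINT x|lborel. c * (cnj (rep_L2 \<Phi> x) * rep_L2 \<Psi> x))"
      unfolding cinner_L2_def using AE_rep_scaleC[of c \<Psi>]
      by (intro integral_cong_AE borel_measurable_times borel_measurable_const prod_measurable)
         (auto simp: algebra_simps elim: eventually_mono)
    thus ?thesis by (simp add: cinner_L2_def)
  qed
  show "cinner \<Phi> (c *\<^sub>C \<Psi>) = c * cinner \<Phi> \<Psi>" by (rule S)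
  show "inner \<Phi> \<Psi> = Re (cinner \<Phi> \<Psi>)" by (rule inner_L2_def)
  show comi: "inner \<Phi> \<Psi> = inner \<Psi> \<Phi>" for \<Phi> \<Psi> :: L2
    using com[of \<Phi> \<Psi>] by (simp add: inner_L2_def)
  have "inner \<Xi> (\<Phi> + \<Psi>) = inner \<Xi> \<Phi> + inner \<Xi> \<Psi>" by (simp add: inner_L2_def A)
  thus "inner (\<Phi> + \<Psi>) \<Xi> = inner \<Phi> \<Xi> + inner \<Psi> \<Xi>" by (simp add: comi)
  have "inner \<Psi> (r *\<^sub>R \<Phi>) = r * inner \<Psi> \<Phi>" by (simp add: inner_L2_def scaleR_L2_def S)
  thus "inner (r *\<^sub>R \<Phi>) \<Psi> = r * inner \<Phi> \<Psi>" by (simp add: comi)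
  show "0 \<le> inner \<Phi> \<Phi>" by (simp add: inner_L2_def cinner_L2_self)
  have "inner \<Phi> \<Phi> = 0 \<longleftrightarrow> (AE x in lborel. (cmod (rep_L2 \<Phi> x))\<^sup>2 = 0)"
    by (simp add: inner_L2_def cinner_L2_self integrable_rep_sq integral_nonneg_eq_0_iff_AE)
  also have "\<dots> \<longleftrightarrow> \<Phi> = 0"
  proof
    assume "AE x in lborel. (cmod (rep_L2 \<Phi> x))\<^sup>2 = 0"
    from this AE_rep_zero have "AE x in lborel. rep_L2 \<Phi> x = rep_L2 0 x" by eventually_elim simp
    thus "\<Phi> = 0" by (rule L2_eqI)
  qed (use AE_rep_zero in \<open>auto elim: eventually_mono\<close>)
  finally show "inner \<Phi> \<Phi> = 0 \<longleftrightarrow> \<Phi> = 0" .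
  show "norm \<Phi> = sqrt (inner \<Phi> \<Phi>)" by (rule norm_L2_def)
qed

end

lemma norm_L2_sq: "(norm \<Phi>)\<^sup>2 = (LINT x|lborel. (cmod (rep_L2 \<Phi> x))\<^sup>2)"
  by (simp add: power2_norm_eq_inner inner_L2_def cinner_L2_self)

lemma nn_integral_rep_sq: "(\<integral>\<^sup>+x. ennreal ((cmod (rep_L2 \<Phi> x))\<^sup>2) \<partial>lborel) = ennreal ((norm \<Phi>)\<^sup>2)"
  unfolding norm_L2_sq by (intro nn_integral_eq_integral integrable_rep_sq) simp

lemma AE_norm_summable_convergent:
  fixes X :: "nat \<Rightarrow> L2"
  assumes "\<And>n. norm (X (Suc n) - X n) \<le> (1/2) ^ n"
  shows "AE x in lborel. convergent (\<lambda>n. rep_L2 (X n) x)"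
proof -
  define d where "d n x = rep_L2 (X (Suc n)) x - rep_L2 (X n) x" for n x
  have dm [measurable]: "d n \<in> borel_measurable borel" for n unfolding d_def by measurable
  have "(\<integral>\<^sup>+x. (\<Sum>n. ennreal (2 ^ n * (cmod (d n x))\<^sup>2)) \<partial>lborel)
      = (\<Sum>n. \<integral>\<^sup>+x. ennreal (2 ^ n * (cmod (d n x))\<^sup>2) \<partial>lborel)"
    by (rule nn_integral_suminf) measurable
  also have "\<dots> \<le> (\<Sum>n. ennreal ((1/2) ^ n))"
  proof (rule suminf_le)
    fix n
    have "(\<integral>\<^sup>+x. ennreal (2 ^ n * (cmod (d n x))\<^sup>2) \<partial>lborel)
        = ennreal (2 ^ n) * (\<integral>\<^sup>+x. ennreal ((cmod (d n x))\<^sup>2) \<partial>lborel)"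
      by (subst nn_integral_cmult [symmetric]) (auto simp: ennreal_mult)
    also have "(\<integral>\<^sup>+x. ennreal ((cmod (d n x))\<^sup>2) \<partial>lborel) = ennreal ((norm (X (Suc n) - X n))\<^sup>2)"
      unfolding nn_integral_rep_sq [symmetric]
      using AE_rep_minus[of "X (Suc n)" "X n"]
      by (intro nn_integral_cong_AE) (auto simp: d_def elim: eventually_mono)
    also have "ennreal (2 ^ n) * ennreal ((norm (X (Suc n) - X n))\<^sup>2) \<le> ennreal (2 ^ n) * ennreal (((1/2) ^ n)\<^sup>2)"
      by (intro mult_left_mono ennreal_leI power_mono assms) auto
    also have "\<dots> = ennreal ((1/2) ^ n)"
      by (subst ennreal_mult [symmetric]) (auto simp: power2_eq_square field_simps)
    finally show "(\<integral>\<^sup>+x. ennreal (2 ^ n * (cmod (d n x))\<^sup>2) \<partial>lborel) \<le> ennreal ((1/2) ^ n)" .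
  qed auto
  also have "\<dots> = ennreal (\<Sum>n. (1/2) ^ n)"
    by (intro suminf_ennreal2 summable_geometric) auto
  also have "\<dots> < \<infinity>" by simp
  finally have "AE x in lborel. (\<Sum>n. ennreal (2 ^ n * (cmod (d n x))\<^sup>2)) \<noteq> \<infinity>"
    by (intro nn_integral_noteq_infinite) auto
  thus ?thesis
  proof eventually_elim
    case (elim x)
    define C where "C = (\<Sum>n. 2 ^ n * (cmod (d n x))\<^sup>2)"
    have sm: "summable (\<lambda>n. 2 ^ n * (cmod (d n x))\<^sup>2)"
      by (rule summable_suminf_not_top) (use elim in auto)
    have le: "2 ^ n * (cmod (d n x))\<^sup>2 \<le> C" for n
      unfolding C_def using sum_le_suminf[OF sm, of "{n}"] by auto
    have C0: "0 \<le> C" using le[of 0] by (rule order_trans [rotated]) simp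
    have "cmod (d n x) \<le> sqrt C * (sqrt (1/2)) ^ n" for n
    proof -
      have "(cmod (d n x))\<^sup>2 \<le> C * (1/2) ^ n" using le[of n] by (simp add: field_simps)
      hence "cmod (d n x) \<le> sqrt (C * (1/2) ^ n)" by (rule real_le_rsqrt)
      thus ?thesis by (simp only: real_sqrt_mult real_sqrt_power)
    qed
    hence bd: "\<exists>N. \<forall>n\<ge>N. norm (d n x) \<le> sqrt C * (sqrt (1/2)) ^ n" by blast
    have sg: "summable (\<lambda>n. sqrt C * (sqrt (1/2)) ^ n)"
      by (intro summable_mult summable_geometric) (auto simp: real_sqrt_divide)
    have "summable (\<lambda>n. d n x)" by (rule summable_comparison_test[OF bd sg])
    hence "convergent (\<lambda>n. \<Sum>i<n. d i x)" by (simp add: summable_iff_convergent)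
    hence "convergent (\<lambda>n. rep_L2 (X n) x - rep_L2 (X 0) x)"
      unfolding d_def by (simp only: sum_lessThan_telescope[of "\<lambda>n. rep_L2 (X n) x"])
    hence "convergent (\<lambda>n. (rep_L2 (X n) x - rep_L2 (X 0) x) + rep_L2 (X 0) x)"
      by (intro convergent_add convergent_const)
    thus ?case by simp
  qed
qed

lemma L2_convergent_of_AE:
  fixes X :: "nat \<Rightarrow> L2"
  assumes cau: "Cauchy X" and ae: "AE x in lborel. convergent (\<lambda>n. rep_L2 (X n) x)"
  shows "convergent X"
proof -
  define f where "f x = lim (\<lambda>n. rep_L2 (X n) x)" for x
  have fm [measurable]: "f \<in> borel_measurable borel"
    unfolding f_def by measurable
  have conv: "AE x in lborel. (\<lambda>n. rep_L2 (X n) x) \<longlonglongrightarrow> f x"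
    using ae by eventually_elim (simp add: f_def convergent_LIMSEQ_iff)
  have fatou: "(\<integral>\<^sup>+x. ennreal ((cmod (f x - rep_L2 (X m) x))\<^sup>2) \<partial>lborel) \<le> ennreal (e\<^sup>2)"
    if "\<And>n. n \<ge> m \<Longrightarrow> norm (X n - X m) \<le> e" for m e
  proof -
    have "(\<integral>\<^sup>+x. ennreal ((cmod (f x - rep_L2 (X m) x))\<^sup>2) \<partial>lborel)
        = (\<integral>\<^sup>+x. liminf (\<lambda>n. ennreal ((cmod (rep_L2 (X n) x - rep_L2 (X m) x))\<^sup>2)) \<partial>lborel)"
    proof (rule nn_integral_cong_AE, use conv in eventually_elim)
      fix x assume "(\<lambda>n. rep_L2 (X n) x) \<longlonglongrightarrow> f x"
      hence "(\<lambda>n. ennreal ((cmod (rep_L2 (X n) x - rep_L2 (X m) x))\<^sup>2))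
          \<longlonglongrightarrow> ennreal ((cmod (f x - rep_L2 (X m) x))\<^sup>2)"
        by (intro tendsto_intros tendsto_ennrealI)
      thus "ennreal ((cmod (f x - rep_L2 (X m) x))\<^sup>2)
          = liminf (\<lambda>n. ennreal ((cmod (rep_L2 (X n) x - rep_L2 (X m) x))\<^sup>2))"
        by (rule lim_imp_Liminf[OF sequentially_bot, symmetric])
    qed
    also have "\<dots> \<le> liminf (\<lambda>n. \<integral>\<^sup>+x. ennreal ((cmod (rep_L2 (X n) x - rep_L2 (X m) x))\<^sup>2) \<partial>lborel)"
      by (rule nn_integral_liminf) measurable
    also have "(\<lambda>n. \<integral>\<^sup>+x. ennreal ((cmod (rep_L2 (X n) x - rep_L2 (X m) x))\<^sup>2) \<partial>lborel)
        = (\<lambda>n. ennreal ((norm (X n - X m))\<^sup>2))"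
    proof
      fix n
      show "(\<integral>\<^sup>+x. ennreal ((cmod (rep_L2 (X n) x - rep_L2 (X m) x))\<^sup>2) \<partial>lborel)
          = ennreal ((norm (X n - X m))\<^sup>2)"
        unfolding nn_integral_rep_sq [symmetric] using AE_rep_minus[of "X n" "X m"]
        by (intro nn_integral_cong_AE) (auto elim: eventually_mono)
    qed
    also have "liminf (\<lambda>n. ennreal ((norm (X n - X m))\<^sup>2)) \<le> liminf (\<lambda>n. ennreal (e\<^sup>2))"
    proof (rule Liminf_mono)
      show "\<forall>\<^sub>F n in sequentially. ennreal ((norm (X n - X m))\<^sup>2) \<le> ennreal (e\<^sup>2)"
        using eventually_ge_at_top[of m]
        by eventually_elim (intro ennreal_leI power_mono that norm_ge_zero)
    qed
    also have "\<dots> = ennreal (e\<^sup>2)" by (simp add: Liminf_const)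
    finally show ?thesis .
  qed
  have sqd: "sq_integrable (\<lambda>x. f x - rep_L2 (X m) x)"
    if "\<And>n. n \<ge> m \<Longrightarrow> norm (X n - X m) \<le> e" for m e
    using fatou[OF that] unfolding sq_integrable_def
    by (auto intro!: integrableI_nonneg le_less_trans[OF _ ennreal_less_top[of "e\<^sup>2"]])
  obtain M where M: "\<And>m n. m \<ge> M \<Longrightarrow> n \<ge> M \<Longrightarrow> norm (X m - X n) < 1"
    using CauchyD[OF cau, of 1] by auto
  have "sq_integrable (\<lambda>x. f x - rep_L2 (X M) x)"
    by (rule sqd[of M 1]) (use M in \<open>auto intro: less_imp_le\<close>)
  from sq_integrable_add[OF this sq_integrable_rep[of "X M"]] have sqf: "sq_integrable f" by simp
  have "X \<longlonglongrightarrow> abs_L2 f"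
  proof (rule LIMSEQ_I)
    fix r :: real assume r: "r > 0"
    then obtain K where K: "\<And>m n. m \<ge> K \<Longrightarrow> n \<ge> K \<Longrightarrow> norm (X m - X n) < r / 2"
      using CauchyD[OF cau, of "r / 2"] by auto
    show "\<exists>no. \<forall>n\<ge>no. norm (X n - abs_L2 f) < r"
    proof (intro exI allI impI)
      fix m assume m: "m \<ge> K"
      have "ennreal ((norm (abs_L2 f - X m))\<^sup>2)
          = (\<integral>\<^sup>+x. ennreal ((cmod (f x - rep_L2 (X m) x))\<^sup>2) \<partial>lborel)"
        unfolding nn_integral_rep_sq [symmetric]
      proof (rule nn_integral_cong_AE)
        show "AE x in lborel. ennreal ((cmod (rep_L2 (abs_L2 f - X m) x))\<^sup>2)
            = ennreal ((cmod (f x - rep_L2 (X m) x))\<^sup>2)"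
          using AE_rep_minus[of "abs_L2 f" "X m"] AE_rep_abs[OF sqf] by eventually_elim simp
      qed
      also have "\<dots> \<le> ennreal ((r / 2)\<^sup>2)"
        by (rule fatou) (use K m in \<open>auto intro: less_imp_le\<close>)
      finally have "(norm (abs_L2 f - X m))\<^sup>2 \<le> (r / 2)\<^sup>2" by simp
      hence "norm (abs_L2 f - X m) \<le> r / 2" by (rule power2_le_imp_le) (use r in simp)
      thus "norm (X m - abs_L2 f) < r" using r by (simp add: norm_minus_commute)
    qed
  qed
  thus ?thesis by (auto simp: convergent_def)
qed

instance L2 :: complex_hilbert
proof
  fix X :: "nat \<Rightarrow> L2" assume cau: "Cauchy X"
  have "\<exists>r. strict_mono r \<and> (\<forall>n. norm (X (r (Suc n)) - X (r n)) \<le> (1/2) ^ n)"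
  proof -
    have "\<exists>N. \<forall>m\<ge>N. \<forall>n\<ge>N. norm (X m - X n) < (1/2) ^ k" for k :: nat
      by (rule CauchyD[OF cau]) simp
    then obtain N where N: "\<And>k m n. m \<ge> N k \<Longrightarrow> n \<ge> N k \<Longrightarrow> norm (X m - X n) < (1/2) ^ k"
      by metis
    define r where "r = rec_nat (N 0) (\<lambda>k a. max (Suc a) (N (Suc k)))"
    have r0: "r 0 = N 0" and rS: "\<And>k. r (Suc k) = max (Suc (r k)) (N (Suc k))"
      by (simp_all add: r_def)
    have ge: "r k \<ge> N k" for k by (cases k) (simp_all add: r0 rS)
    have mono: "strict_mono r" by (rule strict_mono_Suc_iff[THEN iffD2]) (auto simp: rS less_max_iff_disj)
    moreover have "norm (X (r (Suc n)) - X (r n)) \<le> (1/2) ^ n" for n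
      by (intro less_imp_le N ge order_trans[OF ge[of n]]) (simp add: rS)
    ultimately show ?thesis by blast
  qed
  then obtain r where r: "strict_mono r" "\<And>n. norm (X (r (Suc n)) - X (r n)) \<le> (1/2) ^ n" by blast
  have "convergent (X \<circ> r)"
  proof (rule L2_convergent_of_AE)
    show "Cauchy (X \<circ> r)" using cau r(1) by (rule Cauchy_subseq_Cauchy)
    show "AE x in lborel. convergent (\<lambda>n. rep_L2 ((X \<circ> r) n) x)"
      by (rule AE_norm_summable_convergent) (simp add: r(2))
  qed
  then obtain L where "(X \<circ> r) \<longlonglongrightarrow> L" by (auto simp: convergent_def)
  from Cauchy_converges_subseq[OF cau r(1) this] show "convergent X"
    by (auto simp: convergent_def)
qed

section \<open>The position form and the position operator\<close>

text \<open>$L^2(A)$ as the closed subspace of $L^2(\mathbb{R})$ of functions vanishing outside \<^term>\<open>A\<close>.\<close>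

definition L2_on :: "real set \<Rightarrow> L2 set" where
  "L2_on A = {\<Phi>. AE x in lborel. x \<notin> A \<longrightarrow> rep_L2 \<Phi> x = 0}"

definition restrict_L2 :: "real set \<Rightarrow> L2 \<Rightarrow> L2" where
  "restrict_L2 A \<Phi> = abs_L2 (\<lambda>x. indicator A x * rep_L2 \<Phi> x)"

definition unit_cell :: "int \<Rightarrow> real set" where
  "unit_cell k = {of_int k..<of_int k + 1}"

definition cell_proj :: "int set \<Rightarrow> L2 \<Rightarrow> L2" where
  "cell_proj \<Delta> = restrict_L2 (\<Union>k\<in>\<Delta>. unit_cell k)"

definition piecewise_continuous :: "(real \<Rightarrow> complex) \<Rightarrow> bool" where
  "piecewise_continuous f \<longleftrightarrow>
    (\<forall>a b. finite {x\<in>{a..b}. \<not> isCont f x}) \<and>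
    (\<forall>x. \<not> isCont f x \<longrightarrow> (\<exists>l. (f \<longlongrightarrow> l) (at_left x)) \<and> (\<exists>r. (f \<longlongrightarrow> r) (at_right x)))"

definition pc_domain :: "L2 set" where
  "pc_domain = {\<Phi>. \<exists>f. piecewise_continuous f \<and> compact (closure {x. f x \<noteq> 0}) \<and>
    (AE x in lborel. rep_L2 \<Phi> x = f x)}"

definition position_form :: "L2 \<Rightarrow> L2 \<Rightarrow> complex" where
  "position_form \<Phi> \<Psi> = (LINT x|lborel. complex_of_real x * cnj (rep_L2 \<Phi> x) * rep_L2 \<Psi> x)"

definition position_quad :: "L2 \<Rightarrow> complex" where
  "position_quad \<Phi> = position_form \<Phi> \<Phi>"

definition position_dom :: "L2 set" where
  "position_dom = {\<Phi>. integrable lborel (\<lambda>x. x\<^sup>2 * (cmod (rep_L2 \<Phi> x))\<^sup>2)}"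

definition position_op :: "L2 \<Rightarrow> L2" where
  "position_op \<Phi> = abs_L2 (\<lambda>x. complex_of_real x * rep_L2 \<Phi> x)"

text \<open>The form $q_k$, on \<^term>\<open>cell_proj {k} ` pc_domain\<close>.\<close>

definition cell_quad :: "int \<Rightarrow> L2 \<Rightarrow> complex" where
  "cell_quad k \<Phi> = complex_of_real (LINT x:unit_cell k|lborel. x * (cmod (rep_L2 \<Phi> x))\<^sup>2)"

lemma AE_rep_position_op:
  assumes "\<Phi> \<in> position_dom"
  shows "AE x in lborel. rep_L2 (position_op \<Phi>) x = complex_of_real x * rep_L2 \<Phi> x"
  unfolding position_op_def using assms
  by (intro AE_rep_abs) (auto simp: sq_integrable_def position_dom_def norm_mult power_mult_distrib)

lemma sets_cells [measurable, simp]: "(\<Union>k\<in>\<Delta>. unit_cell k) \<in> sets borel"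
  by (intro sets.countable_UN') (auto simp: unit_cell_def)

lemma sets_unit_cell [measurable, simp]: "unit_cell k \<in> sets borel"
  by (simp add: unit_cell_def)

lemma AE_rep_restrict:
  assumes [measurable]: "A \<in> sets borel"
  shows "AE x in lborel. rep_L2 (restrict_L2 A \<Phi>) x = indicator A x * rep_L2 \<Phi> x"
  unfolding restrict_L2_def
proof (intro AE_rep_abs sq_integrable_dominated[OF sq_integrable_rep[of \<Phi>]])
  show "(\<lambda>x. indicator A x * rep_L2 \<Phi> x) \<in> borel_measurable borel" by measurable
qed (auto simp: norm_mult split: split_indicator)

lemma restrict_L2_add:
  assumes "A \<in> sets borel"
  shows "restrict_L2 A (\<Phi> + \<Psi>) = restrict_L2 A \<Phi> + restrict_L2 A \<Psi>"
  by (rule L2_eqI, use AE_rep_restrict[OF assms, of "\<Phi> + \<Psi>"] AE_rep_restrict[OF assms, of \<Phi>]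
      AE_rep_restrict[OF assms, of \<Psi>] AE_rep_add[of \<Phi> \<Psi>]
      AE_rep_add[of "restrict_L2 A \<Phi>" "restrict_L2 A \<Psi>"] in eventually_elim, simp add: algebra_simps)

lemma restrict_L2_minus:
  assumes "A \<in> sets borel"
  shows "restrict_L2 A (\<Phi> - \<Psi>) = restrict_L2 A \<Phi> - restrict_L2 A \<Psi>"
  using restrict_L2_add[OF assms, of "\<Phi> - \<Psi>" \<Psi>] by simp

lemma restrict_L2_scaleC:
  assumes "A \<in> sets borel"
  shows "restrict_L2 A (c *\<^sub>C \<Phi>) = c *\<^sub>C restrict_L2 A \<Phi>"
  by (rule L2_eqI, use AE_rep_restrict[OF assms, of "c *\<^sub>C \<Phi>"] AE_rep_restrict[OF assms, of \<Phi>]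
      AE_rep_scaleC[of c \<Phi>] AE_rep_scaleC[of c "restrict_L2 A \<Phi>"] in eventually_elim, simp)

lemma mem_L2_on_iff:
  assumes "A \<in> sets borel"
  shows "\<Phi> \<in> L2_on A \<longleftrightarrow> restrict_L2 A \<Phi> = \<Phi>"
proof
  assume "\<Phi> \<in> L2_on A"
  hence "AE x in lborel. x \<notin> A \<longrightarrow> rep_L2 \<Phi> x = 0" by (simp add: L2_on_def)
  with AE_rep_restrict[OF assms, of \<Phi>]
  have "AE x in lborel. rep_L2 (restrict_L2 A \<Phi>) x = rep_L2 \<Phi> x"
    by eventually_elim (auto split: split_indicator)
  thus "restrict_L2 A \<Phi> = \<Phi>" by (rule L2_eqI)
next
  assume "restrict_L2 A \<Phi> = \<Phi>"
  with AE_rep_restrict[OF assms, of \<Phi>] have "AE x in lborel. rep_L2 \<Phi> x = indicator A x * rep_L2 \<Phi> x"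
    by simp
  thus "\<Phi> \<in> L2_on A" unfolding L2_on_def mem_Collect_eq by eventually_elim auto
qed

lemma restrict_L2_mem:
  assumes "A \<in> sets borel"
  shows "restrict_L2 A \<Phi> \<in> L2_on A"
  unfolding L2_on_def mem_Collect_eq using AE_rep_restrict[OF assms, of \<Phi>] by eventually_elim auto

lemma orthogonal_projection_restrict_L2:
  assumes "A \<in> sets borel"
  shows "orthogonal_projection UNIV (restrict_L2 A)" and "range (restrict_L2 A) = L2_on A"
proof -
  have "cinner (restrict_L2 A \<Phi>) \<Psi> = cinner \<Phi> (restrict_L2 A \<Psi>)" for \<Phi> \<Psi>
    unfolding cinner_L2_def
  proof (rule integral_cong_AE)
    show "AE x in lborel. cnj (rep_L2 (restrict_L2 A \<Phi>) x) * rep_L2 \<Psi> x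
        = cnj (rep_L2 \<Phi> x) * rep_L2 (restrict_L2 A \<Psi>) x"
      using AE_rep_restrict[OF assms, of \<Phi>] AE_rep_restrict[OF assms, of \<Psi>]
      by eventually_elim (auto split: split_indicator)
  qed (rule prod_measurable)+
  thus "orthogonal_projection UNIV (restrict_L2 A)"
    using mem_L2_on_iff[OF assms] restrict_L2_mem[OF assms]
    by (auto simp: orthogonal_projection_def clinear_on_def restrict_L2_add restrict_L2_scaleC assms)
  show "range (restrict_L2 A) = L2_on A"
    using mem_L2_on_iff[OF assms] restrict_L2_mem[OF assms] by (auto intro: rangeI) (metis rangeI)
qed

lemma norm_restrict_L2_le:
  assumes "A \<in> sets borel"
  shows "norm (restrict_L2 A \<Phi>) \<le> norm \<Phi>"
proof (rule power2_le_imp_le)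
  show "(norm (restrict_L2 A \<Phi>))\<^sup>2 \<le> (norm \<Phi>)\<^sup>2"
    unfolding norm_L2_sq
  proof (rule integral_mono_AE[OF integrable_rep_sq integrable_rep_sq])
    show "AE x in lborel. (cmod (rep_L2 (restrict_L2 A \<Phi>) x))\<^sup>2 \<le> (cmod (rep_L2 \<Phi> x))\<^sup>2"
      using AE_rep_restrict[OF assms, of \<Phi>] by eventually_elim (auto split: split_indicator)
  qed
qed simp

lemma closed_csubspace_L2_on:
  assumes "A \<in> sets borel"
  shows "csubspace (L2_on A)" and "closed (L2_on A)"
proof -
  have "restrict_L2 A 0 = 0" using restrict_L2_add[OF assms, of 0 0] by simp
  thus "csubspace (L2_on A)"
    by (auto simp: csubspace_def mem_L2_on_iff assms restrict_L2_add restrict_L2_scaleC)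
  show "closed (L2_on A)"
    unfolding closed_sequential_limits
  proof (intro allI impI, elim conjE)
    fix X L assume X: "\<forall>n. X n \<in> L2_on A" and lim: "X \<longlonglongrightarrow> L"
    have "(\<lambda>n. restrict_L2 A (X n)) \<longlonglongrightarrow> restrict_L2 A L"
    proof (rule Lim_transform_bound[OF _ LIM_zero[OF lim], THEN LIM_zero_cancel])
      show "\<forall>\<^sub>F n in sequentially. norm (restrict_L2 A (X n) - restrict_L2 A L) \<le> norm (X n - L)"
        by (simp add: restrict_L2_minus [symmetric] norm_restrict_L2_le assms)
    qed
    moreover have "(\<lambda>n. restrict_L2 A (X n)) = X" using X mem_L2_on_iff[OF assms] by auto
    ultimately have "restrict_L2 A L = L" using lim LIMSEQ_unique by auto
    thus "L \<in> L2_on A" using mem_L2_on_iff[OF assms] by simp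
  qed
qed

lemma cell_quad_cell_proj:
  "cell_quad k (cell_proj {k} \<Phi>) = position_quad (cell_proj {k} \<Phi>)"
  "cell_quad k (cell_proj {k} \<Phi>)
    = complex_of_real (LINT x:unit_cell k|lborel. x * (cmod (rep_L2 \<Phi> x))\<^sup>2)"
proof -
  let ?\<Psi> = "cell_proj {k} \<Phi>"
  have ae: "AE x in lborel. rep_L2 ?\<Psi> x = indicator (unit_cell k) x * rep_L2 \<Phi> x"
    unfolding cell_proj_def using AE_rep_restrict[of "unit_cell k" \<Phi>] by simp
  have "position_quad ?\<Psi>
      = (LINT x|lborel. complex_of_real (indicator (unit_cell k) x * (x * (cmod (rep_L2 ?\<Psi> x))\<^sup>2)))"
    unfolding position_quad_def position_form_def
  proof (rule integral_cong_AE)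
    have "complex_of_real x * cnj z * z = complex_of_real (x * (cmod z)\<^sup>2)" for x z
      using complex_norm_square[of z] by (simp add: mult.commute mult.left_commute)
    thus "AE x in lborel. complex_of_real x * cnj (rep_L2 ?\<Psi> x) * rep_L2 ?\<Psi> x
        = complex_of_real (indicator (unit_cell k) x * (x * (cmod (rep_L2 ?\<Psi> x))\<^sup>2))"
      using ae by (auto elim!: eventually_mono split: split_indicator)
    have [measurable]: "(\<lambda>x. cnj (rep_L2 ?\<Psi> x)) \<in> borel_measurable borel"
      using borel_measurable_continuous_on[OF continuous_on_cnj[OF continuous_on_id] rep_measurable[of ?\<Psi>]] by simp
    show "(\<lambda>x. complex_of_real x * cnj (rep_L2 ?\<Psi> x) * rep_L2 ?\<Psi> x) \<in> borel_measurable lborel"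
      by measurable
  qed measurable
  thus "cell_quad k ?\<Psi> = position_quad ?\<Psi>"
    by (simp only: cell_quad_def set_lebesgue_integral_def integral_complex_of_real real_scaleR_def)
  have "(LINT x:unit_cell k|lborel. x * (cmod (rep_L2 ?\<Psi> x))\<^sup>2)
      = (LINT x:unit_cell k|lborel. x * (cmod (rep_L2 \<Phi> x))\<^sup>2)"
    unfolding set_lebesgue_integral_def
    by (rule integral_cong_AE) (measurable, use ae in \<open>auto elim!: eventually_mono split: split_indicator\<close>)
  thus "cell_quad k ?\<Psi> = complex_of_real (LINT x:unit_cell k|lborel. x * (cmod (rep_L2 \<Phi> x))\<^sup>2)"
    by (simp add: cell_quad_def)
qed

end

theory Submission
  imports Defs
begin

text \<open>Everything is reduced to weighted integrals of \<open>\<bar>\<Phi>\<bar>\<^sup>2\<close>. The resolution of the identity of the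
  position operator is multiplication by indicator functions, so that the spectral measure of \<open>\<Phi>\<close>
  has density \<open>\<bar>\<Phi>\<bar>\<^sup>2\<close> and the spectral norm is the norm of \<open>L\<^sup>2((1 + \<bar>x\<bar>) dx)\<close>. Cut-off, almost everywhere
  approximation by continuous functions and dominated convergence show that the piecewise continuous
  functions with compact support are dense for every continuous weight, hence are a form core.
  This works on \<open>L\<^sup>2(A)\<close> for any Borel set \<open>A\<close> whose indicator preserves the core, which covers both
  the cells and the whole line.\<close>

section \<open>Weighted domains and the spectral measure of the position operator\<close>

text \<open>Closability comes instead from Q(\<Phi>, \<Psi>) = <T \<Phi>, \<Psi>> on the core.
  Domains are described by nonnegative weights, for which pointwise domination works; the sign of x
  enters only in the values of the form. The weights x^2, |x|, 1 + |x| and 1 give in turn the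
  operator domain, the form domain, the spectral norm and the Hilbert norm, so that one density
  statement serves self-adjointness and the form core alike. Elements are classes with a chosen
  representative, so identities hold only almost everywhere; families of them that are joined are
  indexed by naturals or integers. Restrictions to Borel sets commute. Hence
  \<open>restrict_L2\<close>, defined on the whole space, is also the resolution of the identity of
  the part of T in each cell. Cutting to cells destroys continuity but creates jumps at integers
  only, which is why the core consists of piecewise continuous functions.\<close>

definition weighted_domain :: "(real \<Rightarrow> real) \<Rightarrow> L2 set" where
  "weighted_domain w = {\<Phi>. integrable lborel (\<lambda>x. w x * (cmod (rep_L2 \<Phi> x))\<^sup>2)}"

lemma weighted_domain_dominated:
  assumes "\<Psi> \<in> weighted_domain w" and w: "w \<in> borel_measurable borel" "\<And>x. 0 \<le> w x"
    and "AE x in lborel. cmod (rep_L2 \<Phi> x) \<le> cmod (rep_L2 \<Psi> x)"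
  shows "\<Phi> \<in> weighted_domain w"
proof -
  note w(1) [measurable]
  have "integrable lborel (\<lambda>x. w x * (cmod (rep_L2 \<Phi> x))\<^sup>2)"
  proof (rule Bochner_Integration.integrable_bound)
    show "integrable lborel (\<lambda>x. w x * (cmod (rep_L2 \<Psi> x))\<^sup>2)"
      using assms(1) by (simp add: weighted_domain_def)
    show "AE x in lborel. norm (w x * (cmod (rep_L2 \<Phi> x))\<^sup>2) \<le> norm (w x * (cmod (rep_L2 \<Psi> x))\<^sup>2)"
      using assms(4) by eventually_elim (auto simp: abs_mult w intro!: mult_left_mono power_mono)
  qed measurable
  thus ?thesis by (simp add: weighted_domain_def)
qed

lemma restrict_L2_weighted_domain:
  assumes "\<Phi> \<in> weighted_domain w" "w \<in> borel_measurable borel" "\<And>x. 0 \<le> w x" "A \<in> sets borel"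
  shows "restrict_L2 A \<Phi> \<in> weighted_domain w"
  by (rule weighted_domain_dominated[OF assms(1-3)],
      use AE_rep_restrict[OF assms(4), of \<Phi>] in eventually_elim) (auto split: split_indicator)

text \<open>Stands in for the triangle inequality of the weighted norms, which are handled only
  through their squares. Its factor 2 is paid for later by errors of \<epsilon>/4.\<close>

lemma norm_add_square_le: "(norm (a + b))\<^sup>2 \<le> 2 * (norm a)\<^sup>2 + 2 * (norm b)\<^sup>2"
  for a b :: "'a::real_normed_vector"
proof -
  have "(norm (a + b))\<^sup>2 \<le> (norm a + norm b)\<^sup>2"
    by (intro power_mono norm_triangle_ineq) auto
  also have "\<dots> \<le> 2 * (norm a)\<^sup>2 + 2 * (norm b)\<^sup>2"
    using sum_squares_bound[of "norm a" "norm b"] by (simp add: power2_sum)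
  finally show ?thesis .
qed

lemma csubspace_weighted_domain:
  assumes w: "w \<in> borel_measurable borel" "\<And>x. 0 \<le> w x"
  shows "csubspace (weighted_domain w)"
  unfolding csubspace_def
proof (intro conjI ballI allI)
  note w(1) [measurable]
  have "integrable lborel (\<lambda>x. w x * (cmod (rep_L2 0 x))\<^sup>2) = integrable lborel (\<lambda>x::real. 0::real)"
    using AE_rep_zero by (intro integrable_cong_AE) (auto elim: eventually_mono)
  thus "0 \<in> weighted_domain w" by (simp add: weighted_domain_def)
  fix \<Phi> \<Psi> c assume \<Phi>: "\<Phi> \<in> weighted_domain w"
  { assume \<Psi>: "\<Psi> \<in> weighted_domain w"
    have "integrable lborel (\<lambda>x. w x * (cmod (rep_L2 (\<Phi> + \<Psi>) x))\<^sup>2)"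
    proof (rule Bochner_Integration.integrable_bound)
      show "integrable lborel (\<lambda>x. 2 * (w x * (cmod (rep_L2 \<Phi> x))\<^sup>2) + 2 * (w x * (cmod (rep_L2 \<Psi> x))\<^sup>2))"
        using \<Phi> \<Psi> unfolding weighted_domain_def
        by (intro Bochner_Integration.integrable_add integrable_mult_right) simp_all
      show "AE x in lborel. norm (w x * (cmod (rep_L2 (\<Phi> + \<Psi>) x))\<^sup>2)
          \<le> norm (2 * (w x * (cmod (rep_L2 \<Phi> x))\<^sup>2) + 2 * (w x * (cmod (rep_L2 \<Psi> x))\<^sup>2))"
        using AE_rep_add[of \<Phi> \<Psi>]
      proof eventually_elim
        case (elim x)
        have "w x * (cmod (rep_L2 \<Phi> x + rep_L2 \<Psi> x))\<^sup>2
            \<le> w x * (2 * (cmod (rep_L2 \<Phi> x))\<^sup>2 + 2 * (cmod (rep_L2 \<Psi> x))\<^sup>2)"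
          by (intro mult_left_mono norm_add_square_le w)
        thus ?case by (simp add: elim w algebra_simps)
      qed
    qed measurable
    thus "\<Phi> + \<Psi> \<in> weighted_domain w" by (simp add: weighted_domain_def) }
  have "integrable lborel (\<lambda>x. w x * (cmod (rep_L2 (c *\<^sub>C \<Phi>) x))\<^sup>2)
      = integrable lborel (\<lambda>x. (cmod c)\<^sup>2 * (w x * (cmod (rep_L2 \<Phi> x))\<^sup>2))"
  proof (rule integrable_cong_AE)
    show "AE x in lborel. w x * (cmod (rep_L2 (c *\<^sub>C \<Phi>) x))\<^sup>2
        = (cmod c)\<^sup>2 * (w x * (cmod (rep_L2 \<Phi> x))\<^sup>2)"
      using AE_rep_scaleC[of c \<Phi>] by eventually_elim (simp add: norm_mult power_mult_distrib)
  qed measurable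
  thus "c *\<^sub>C \<Phi> \<in> weighted_domain w" using \<Phi> by (simp add: weighted_domain_def)
qed

lemma position_dom_eq: "position_dom = weighted_domain (\<lambda>x. x\<^sup>2)"
  by (simp add: position_dom_def weighted_domain_def)

text \<open>Since |x| \<le> x^2 + 1, and the constant weight is integrable against every element,
  the operator domain lies in the form domain.\<close>

lemma position_dom_subset: "position_dom \<subseteq> weighted_domain (\<lambda>x. \<bar>x\<bar>)"
proof
  fix \<Phi> assume \<Phi>: "\<Phi> \<in> position_dom"
  have "integrable lborel (\<lambda>x. \<bar>x\<bar> * (cmod (rep_L2 \<Phi> x))\<^sup>2)"
  proof (rule Bochner_Integration.integrable_bound)
    show "integrable lborel (\<lambda>x. x\<^sup>2 * (cmod (rep_L2 \<Phi> x))\<^sup>2 + (cmod (rep_L2 \<Phi> x))\<^sup>2)"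
      using \<Phi> integrable_rep_sq unfolding position_dom_def
      by (intro Bochner_Integration.integrable_add) simp_all
    have le: "\<bar>x\<bar> \<le> x\<^sup>2 + 1" for x :: real
      using sum_squares_bound[of "\<bar>x\<bar>" 1] by auto
    have "\<bar>x\<bar> * (cmod (rep_L2 \<Phi> x))\<^sup>2 \<le> (x\<^sup>2 + 1) * (cmod (rep_L2 \<Phi> x))\<^sup>2" for x
      by (intro mult_right_mono le) simp
    thus "AE x in lborel. norm (\<bar>x\<bar> * (cmod (rep_L2 \<Phi> x))\<^sup>2)
        \<le> norm (x\<^sup>2 * (cmod (rep_L2 \<Phi> x))\<^sup>2 + (cmod (rep_L2 \<Phi> x))\<^sup>2)"
      by (auto simp: algebra_simps abs_mult)
  qed measurable
  thus "\<Phi> \<in> weighted_domain (\<lambda>x. \<bar>x\<bar>)" by (simp add: weighted_domain_def)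
qed

lemma cnj_rep_measurable [measurable]: "(\<lambda>x. cnj (rep_L2 \<Phi> x)) \<in> borel_measurable borel"
  using borel_measurable_continuous_on[OF continuous_on_cnj[OF continuous_on_id] rep_measurable[of \<Phi>]]
  by simp

lemma integrable_position_form:
  assumes "\<Phi> \<in> weighted_domain (\<lambda>x. \<bar>x\<bar>)" "\<Psi> \<in> weighted_domain (\<lambda>x. \<bar>x\<bar>)"
  shows "integrable lborel (\<lambda>x. complex_of_real x * cnj (rep_L2 \<Phi> x) * rep_L2 \<Psi> x)"
proof (rule Bochner_Integration.integrable_bound)
  show "integrable lborel (\<lambda>x. \<bar>x\<bar> * (cmod (rep_L2 \<Phi> x))\<^sup>2 + \<bar>x\<bar> * (cmod (rep_L2 \<Psi> x))\<^sup>2)"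
    using assms unfolding weighted_domain_def
    by (intro Bochner_Integration.integrable_add) simp_all
  have le: "s * t \<le> s\<^sup>2 + t\<^sup>2" if "0 \<le> s" "0 \<le> t" for s t :: real
  proof -
    have "2 * (s * t) \<le> s\<^sup>2 + t\<^sup>2" using sum_squares_bound[of s t] by (simp add: mult.assoc)
    moreover have "0 \<le> s * t" using that by simp
    ultimately show ?thesis by linarith
  qed
  have "\<bar>x\<bar> * (cmod a * cmod b) \<le> \<bar>x\<bar> * ((cmod a)\<^sup>2 + (cmod b)\<^sup>2)" for x a b
    by (intro mult_left_mono le) auto
  thus "AE x in lborel. norm (complex_of_real x * cnj (rep_L2 \<Phi> x) * rep_L2 \<Psi> x)
      \<le> norm (\<bar>x\<bar> * (cmod (rep_L2 \<Phi> x))\<^sup>2 + \<bar>x\<bar> * (cmod (rep_L2 \<Psi> x))\<^sup>2)"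
    by (auto simp: norm_mult algebra_simps)
qed measurable

lemma position_quad_eq:
  "position_quad \<Phi> = complex_of_real (LINT x|lborel. x * (cmod (rep_L2 \<Phi> x))\<^sup>2)"
proof -
  have "complex_of_real x * cnj z * z = complex_of_real (x * (cmod z)\<^sup>2)" for x z
    using complex_norm_square[of z] by (simp add: mult.commute mult.left_commute)
  thus ?thesis by (simp only: position_quad_def position_form_def integral_complex_of_real)
qed

text \<open>The form domain enters through additivity, where the integral of a sum is split. The
  clauses for the first entry follow from those for the second by conjugate symmetry.\<close>

lemma hermitian_form_position_form:
  assumes "csubspace D" "D \<subseteq> weighted_domain (\<lambda>x. \<bar>x\<bar>)"
  shows "hermitian_form D position_form"
proof -
  have comm: "position_form \<Psi> \<Phi> = cnj (position_form \<Phi> \<Psi>)" for \<Phi> \<Psi>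
    unfolding position_form_def Bochner_Integration.integral_cnj [symmetric]
    by (simp add: ac_simps del: Bochner_Integration.integral_cnj)
  have add: "position_form \<Phi> (\<Psi> + \<Xi>) = position_form \<Phi> \<Psi> + position_form \<Phi> \<Xi>"
    if "\<Phi> \<in> D" "\<Psi> \<in> D" "\<Xi> \<in> D" for \<Phi> \<Psi> \<Xi>
  proof -
    have "position_form \<Phi> (\<Psi> + \<Xi>) = (LINT x|lborel. complex_of_real x * cnj (rep_L2 \<Phi> x) * rep_L2 \<Psi> x
        + complex_of_real x * cnj (rep_L2 \<Phi> x) * rep_L2 \<Xi> x)"
      unfolding position_form_def
    proof (rule integral_cong_AE)
      show "AE x in lborel. complex_of_real x * cnj (rep_L2 \<Phi> x) * rep_L2 (\<Psi> + \<Xi>) x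
          = complex_of_real x * cnj (rep_L2 \<Phi> x) * rep_L2 \<Psi> x
            + complex_of_real x * cnj (rep_L2 \<Phi> x) * rep_L2 \<Xi> x"
        using AE_rep_add[of \<Psi> \<Xi>] by eventually_elim (simp add: algebra_simps)
    qed measurable
    also have "\<dots> = position_form \<Phi> \<Psi> + position_form \<Phi> \<Xi>"
      unfolding position_form_def using that assms(2)
      by (intro Bochner_Integration.integral_add integrable_position_form) auto
    finally show ?thesis .
  qed
  have scale: "position_form \<Phi> (c *\<^sub>C \<Psi>) = c * position_form \<Phi> \<Psi>" for c \<Phi> \<Psi>
  proof -
    have "position_form \<Phi> (c *\<^sub>C \<Psi>)
        = (LINT x|lborel. c * (complex_of_real x * cnj (rep_L2 \<Phi> x) * rep_L2 \<Psi> x))"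
      unfolding position_form_def
    proof (rule integral_cong_AE)
      show "AE x in lborel. complex_of_real x * cnj (rep_L2 \<Phi> x) * rep_L2 (c *\<^sub>C \<Psi>) x
          = c * (complex_of_real x * cnj (rep_L2 \<Phi> x) * rep_L2 \<Psi> x)"
        using AE_rep_scaleC[of c \<Psi>] by eventually_elim simp
    qed measurable
    thus ?thesis by (simp add: position_form_def)
  qed
  have add': "position_form (\<Phi> + \<Psi>) \<Xi> = position_form \<Phi> \<Xi> + position_form \<Psi> \<Xi>"
    if "\<Phi> \<in> D" "\<Psi> \<in> D" "\<Xi> \<in> D" for \<Phi> \<Psi> \<Xi>
    using add[OF that(3,1,2)] comm by (metis complex_cnj_add)
  have scale': "position_form (c *\<^sub>C \<Phi>) \<Psi> = cnj c * position_form \<Phi> \<Psi>" for c \<Phi> \<Psi>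
    using scale[of \<Psi> c \<Phi>] comm by (metis complex_cnj_mult)
  show ?thesis
    unfolding hermitian_form_def
    by (intro conjI ballI allI comm assms(1) add add' scale scale')
qed

section \<open>Multiplication by indicators as a projection-valued measure\<close>

lemma L2_on_UNIV: "L2_on UNIV = UNIV"
  by (simp add: L2_on_def)

lemma restrict_L2_UNIV: "restrict_L2 UNIV \<Phi> = \<Phi>"
  using mem_L2_on_iff[of UNIV \<Phi>] by (simp add: L2_on_UNIV)

lemma restrict_L2_restrict:
  assumes "A \<in> sets borel" "B \<in> sets borel"
  shows "restrict_L2 A (restrict_L2 B \<Phi>) = restrict_L2 (A \<inter> B) \<Phi>"
proof (rule L2_eqI)
  have "A \<inter> B \<in> sets borel" using assms by auto
  from AE_rep_restrict[OF this, of \<Phi>] AE_rep_restrict[OF assms(1), of "restrict_L2 B \<Phi>"]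
    AE_rep_restrict[OF assms(2), of \<Phi>]
  show "AE x in lborel. rep_L2 (restrict_L2 A (restrict_L2 B \<Phi>)) x = rep_L2 (restrict_L2 (A \<inter> B) \<Phi>) x"
    by eventually_elim (auto split: split_indicator)
qed

lemma restrict_L2_mem_L2_on:
  assumes "A \<in> sets borel" "\<sigma> \<in> sets borel" "\<Phi> \<in> L2_on A"
  shows "restrict_L2 \<sigma> \<Phi> \<in> L2_on A"
proof -
  have "restrict_L2 A (restrict_L2 \<sigma> \<Phi>) = restrict_L2 \<sigma> (restrict_L2 A \<Phi>)"
    by (simp add: restrict_L2_restrict assms Int_commute)
  also have "restrict_L2 A \<Phi> = \<Phi>" using assms by (simp add: mem_L2_on_iff)
  finally show ?thesis using mem_L2_on_iff[OF assms(1)] by simp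
qed

lemma norm_restrict_L2_sq:
  assumes [measurable]: "A \<in> sets borel"
  shows "(norm (restrict_L2 A \<Phi>))\<^sup>2 = (LINT x:A|lborel. (cmod (rep_L2 \<Phi> x))\<^sup>2)"
  unfolding norm_L2_sq set_lebesgue_integral_def
  by (rule integral_cong_AE, measurable, use AE_rep_restrict[OF assms, of \<Phi>] in eventually_elim)
    (auto split: split_indicator)

lemma norm_restrict_L2_sq_ennreal:
  assumes [measurable]: "A \<in> sets borel"
  shows "ennreal ((norm (restrict_L2 A \<Phi>))\<^sup>2) = (\<integral>\<^sup>+x\<in>A. ennreal ((cmod (rep_L2 \<Phi> x))\<^sup>2) \<partial>lborel)"
  unfolding nn_integral_rep_sq [symmetric]
  by (rule nn_integral_cong_AE, use AE_rep_restrict[OF assms, of \<Phi>] in eventually_elim)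
    (auto split: split_indicator)

text \<open>On Borel sets the set function in \<open>spectral_measure\<close> agrees with a measure
  that already exists, so countable additivity is inherited from the density. Spectral integrals
  thereby become weighted Lebesgue integrals.\<close>

lemma spectral_measure_restrict_L2:
  "spectral_measure restrict_L2 \<Phi> = density lborel (\<lambda>x. ennreal ((cmod (rep_L2 \<Phi> x))\<^sup>2))"
proof -
  have "spectral_measure restrict_L2 \<Phi>
      = measure_of UNIV (sets borel) (emeasure (density lborel (\<lambda>x. ennreal ((cmod (rep_L2 \<Phi> x))\<^sup>2))))"
    unfolding spectral_measure_def
  proof (rule measure_of_eq)
    fix \<sigma> :: "real set" assume "\<sigma> \<in> sigma_sets UNIV (sets borel)"
    hence \<sigma>: "\<sigma> \<in> sets borel" using sets.sigma_sets_eq[of "borel :: real measure"] by simp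
    thus "ennreal ((norm (restrict_L2 \<sigma> \<Phi>))\<^sup>2)
        = emeasure (density lborel (\<lambda>x. ennreal ((cmod (rep_L2 \<Phi> x))\<^sup>2))) \<sigma>"
      by (subst emeasure_density) (auto simp: norm_restrict_L2_sq_ennreal)
  qed simp
  also have "\<dots> = density lborel (\<lambda>x. ennreal ((cmod (rep_L2 \<Phi> x))\<^sup>2))"
    using measure_of_of_measure[of "density lborel (\<lambda>x. ennreal ((cmod (rep_L2 \<Phi> x))\<^sup>2))"] by simp
  finally show ?thesis .
qed

lemma integrable_spectral_measure_restrict_L2:
  fixes w :: "real \<Rightarrow> real"
  assumes "w \<in> borel_measurable borel"
  shows "integrable (spectral_measure restrict_L2 \<Phi>) w \<longleftrightarrow> \<Phi> \<in> weighted_domain w"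
  using assms
  by (simp add: spectral_measure_restrict_L2 weighted_domain_def integrable_density mult.commute)

lemma integral_spectral_measure_restrict_L2:
  fixes w :: "real \<Rightarrow> real"
  assumes "w \<in> borel_measurable borel"
  shows "(LINT l|spectral_measure restrict_L2 \<Phi>. w l) = (LINT x|lborel. w x * (cmod (rep_L2 \<Phi> x))\<^sup>2)"
  using assms by (simp add: spectral_measure_restrict_L2 integral_density mult.commute)

lemma spectral_form_domain_restrict_L2:
  "spectral_form_domain H restrict_L2 = H \<inter> weighted_domain (\<lambda>x. \<bar>x\<bar>)"
  by (auto simp: spectral_form_domain_def integrable_spectral_measure_restrict_L2)

text \<open>By disjointness the n-th partial sum is the restriction to the first n sets. The squared
  norm of the remainder is the integral of |\<Phi>|^2 over what is left of the union, and it
  vanishes by dominated convergence with majorant |\<Phi>|^2.\<close>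

lemma restrict_L2_sums:
  fixes \<sigma> :: "nat \<Rightarrow> real set"
  assumes "range \<sigma> \<subseteq> sets borel" "disjoint_family \<sigma>"
  shows "(\<lambda>n. restrict_L2 (\<sigma> n) \<Phi>) sums restrict_L2 (\<Union>n. \<sigma> n) \<Phi>"
proof -
  have m [measurable]: "\<sigma> n \<in> sets borel" for n using assms(1) by auto
  have sum_eq: "(\<Sum>i<n. restrict_L2 (\<sigma> i) \<Phi>) = restrict_L2 (\<Union>i<n. \<sigma> i) \<Phi>" for n
  proof (induction n)
    case 0
    show ?case
      by (rule L2_eqI, use AE_rep_restrict[of "{}" \<Phi>, simplified] AE_rep_zero in eventually_elim) simp
  next
    case (Suc n)
    have disj: "x \<notin> \<sigma> n" if "x \<in> \<sigma> i" "i < n" for x i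
      using disjoint_family_onD[OF assms(2), of i n] that by auto
    have "restrict_L2 (\<Union>i<n. \<sigma> i) \<Phi> + restrict_L2 (\<sigma> n) \<Phi> = restrict_L2 (\<Union>i<Suc n. \<sigma> i) \<Phi>"
    proof (rule L2_eqI)
      have [simp]: "(\<Union>i<n. \<sigma> i) \<in> sets borel" "(\<Union>i<Suc n. \<sigma> i) \<in> sets borel" by measurable
      show "AE x in lborel. rep_L2 (restrict_L2 (\<Union>i<n. \<sigma> i) \<Phi> + restrict_L2 (\<sigma> n) \<Phi>) x
          = rep_L2 (restrict_L2 (\<Union>i<Suc n. \<sigma> i) \<Phi>) x"
        using AE_rep_add[of "restrict_L2 (\<Union>i<n. \<sigma> i) \<Phi>" "restrict_L2 (\<sigma> n) \<Phi>"]
          AE_rep_restrict[of "\<Union>i<n. \<sigma> i" \<Phi>, simplified] AE_rep_restrict[OF m[of n], of \<Phi>]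
          AE_rep_restrict[of "\<Union>i<Suc n. \<sigma> i" \<Phi>, simplified]
      proof eventually_elim
        case (elim x)
        have "indicator (\<Union>i<n. \<sigma> i) x + indicator (\<sigma> n) x = (indicator (\<Union>i<Suc n. \<sigma> i) x :: complex)"
          using disj by (auto simp: lessThan_Suc split: split_indicator)
        thus ?case using elim by (metis distrib_right)
      qed
    qed
    thus ?case by (simp add: Suc)
  qed
  define S where "S = (\<Union>n. \<sigma> n)"
  have [measurable, simp]: "S \<in> sets borel" "\<And>n. (\<Union>i<n. \<sigma> i) \<in> sets borel"
    unfolding S_def by measurable
  have "(\<lambda>n. LINT x:S - (\<Union>i<n. \<sigma> i)|lborel. (cmod (rep_L2 \<Phi> x))\<^sup>2) \<longlonglongrightarrow> (LINT x::real|lborel. (0::real))"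
    unfolding set_lebesgue_integral_def
  proof (rule integral_dominated_convergence)
    show "integrable lborel (\<lambda>x. (cmod (rep_L2 \<Phi> x))\<^sup>2)" by (rule integrable_rep_sq)
    show "AE x in lborel. (\<lambda>n. indicator (S - (\<Union>i<n. \<sigma> i)) x *\<^sub>R (cmod (rep_L2 \<Phi> x))\<^sup>2) \<longlonglongrightarrow> 0"
    proof (rule AE_I2)
      fix x
      have "\<forall>\<^sub>F n in sequentially. indicator (S - (\<Union>i<n. \<sigma> i)) x *\<^sub>R (cmod (rep_L2 \<Phi> x))\<^sup>2 = 0"
      proof (cases "x \<in> S")
        case True
        then obtain k where "x \<in> \<sigma> k" by (auto simp: S_def)
        thus ?thesis
          by (intro eventually_sequentiallyI[of "Suc k"]) (auto simp: indicator_def Suc_le_eq)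
      qed simp
      thus "(\<lambda>n. indicator (S - (\<Union>i<n. \<sigma> i)) x *\<^sub>R (cmod (rep_L2 \<Phi> x))\<^sup>2) \<longlonglongrightarrow> 0"
        by (rule tendsto_eventually)
    qed
    show "AE x in lborel. norm (indicator (S - (\<Union>i<n. \<sigma> i)) x *\<^sub>R (cmod (rep_L2 \<Phi> x))\<^sup>2)
        \<le> (cmod (rep_L2 \<Phi> x))\<^sup>2" for n
      by (auto split: split_indicator)
  qed measurable
  hence "(\<lambda>n. (norm (restrict_L2 (S - (\<Union>i<n. \<sigma> i)) \<Phi>))\<^sup>2) \<longlonglongrightarrow> 0"
    by (simp add: norm_restrict_L2_sq)
  moreover have "restrict_L2 S \<Phi> - restrict_L2 (\<Union>i<n. \<sigma> i) \<Phi> = restrict_L2 (S - (\<Union>i<n. \<sigma> i)) \<Phi>" for n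
  proof (rule L2_eqI)
    have sub: "(\<Union>i<n. \<sigma> i) \<subseteq> S" by (auto simp: S_def)
    have [simp]: "S - (\<Union>i<n. \<sigma> i) \<in> sets borel" by measurable
    show "AE x in lborel. rep_L2 (restrict_L2 S \<Phi> - restrict_L2 (\<Union>i<n. \<sigma> i) \<Phi>) x
        = rep_L2 (restrict_L2 (S - (\<Union>i<n. \<sigma> i)) \<Phi>) x"
      using AE_rep_minus[of "restrict_L2 S \<Phi>" "restrict_L2 (\<Union>i<n. \<sigma> i) \<Phi>"]
        AE_rep_restrict[of S \<Phi>, simplified] AE_rep_restrict[of "\<Union>i<n. \<sigma> i" \<Phi>, simplified]
        AE_rep_restrict[of "S - (\<Union>i<n. \<sigma> i)" \<Phi>, simplified]
    proof eventually_elim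
      case (elim x)
      have "indicator S x - indicator (\<Union>i<n. \<sigma> i) x = (indicator (S - (\<Union>i<n. \<sigma> i)) x :: complex)"
        using sub by (auto split: split_indicator)
      thus ?case using elim by (metis left_diff_distrib)
    qed
  qed
  ultimately have "(\<lambda>n. (norm (restrict_L2 S \<Phi> - restrict_L2 (\<Union>i<n. \<sigma> i) \<Phi>))\<^sup>2) \<longlonglongrightarrow> 0" by simp
  from tendsto_real_sqrt[OF this]
  have "(\<lambda>n. norm (restrict_L2 (\<Union>i<n. \<sigma> i) \<Phi> - restrict_L2 S \<Phi>)) \<longlonglongrightarrow> 0"
    by (simp add: norm_minus_commute)
  thus ?thesis
    unfolding sums_def sum_eq S_def [symmetric] using LIM_zero_cancel tendsto_norm_zero_iff by blast
qed

text \<open>Restrictions commute with the projection onto \<open>L2_on A\<close>, so they leave this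
  subspace invariant and the properties on the whole space carry over.\<close>

lemma resolution_of_identity_restrict_L2:
  assumes A: "A \<in> sets borel"
  shows "resolution_of_identity (L2_on A) restrict_L2"
proof -
  have "orthogonal_projection (L2_on A) (restrict_L2 \<sigma>)" if "\<sigma> \<in> sets borel" for \<sigma>
    using orthogonal_projection_restrict_L2(1)[OF that] restrict_L2_mem_L2_on[OF A that]
    by (auto simp: orthogonal_projection_def clinear_on_def)
  moreover have "restrict_L2 {} \<Phi> = 0" for \<Phi>
    by (rule L2_eqI, use AE_rep_restrict[of "{}" \<Phi>, simplified] AE_rep_zero in eventually_elim) simp
  ultimately show ?thesis
    unfolding resolution_of_identity_def
    by (auto simp: restrict_L2_UNIV restrict_L2_restrict restrict_L2_sums)
qed

text \<open>Only diagonal matrix elements are compared: both sides are the integral of x |\<Phi>|^2.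
  Integrability of the squared spectral variable is the weight x^2.\<close>

lemma is_resolution_of_position_op:
  assumes A: "A \<in> sets borel"
  shows "is_resolution_of (L2_on A) (L2_on A \<inter> position_dom) position_op restrict_L2"
proof -
  have "cinner \<Phi> (position_op \<Phi>) = position_quad \<Phi>" if "\<Phi> \<in> position_dom" for \<Phi>
    unfolding cinner_L2_def position_quad_def position_form_def
    by (rule integral_cong_AE, measurable, use AE_rep_position_op[OF that] in eventually_elim) simp
  thus ?thesis
    unfolding is_resolution_of_def using resolution_of_identity_restrict_L2[OF A]
    by (auto simp: position_dom_eq integrable_spectral_measure_restrict_L2
        integral_spectral_measure_restrict_L2 position_quad_eq)
qed

section \<open>Density of the piecewise continuous functions\<close>

text \<open>At a point of continuity the value itself is the limit from either side, so one-sided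
  limits exist everywhere and later arguments need not distinguish the two kinds of points.\<close>

lemma piecewise_continuous_limits:
  assumes "piecewise_continuous f"
  shows "\<exists>l. (f \<longlongrightarrow> l) (at_left x)" and "\<exists>l. (f \<longlongrightarrow> l) (at_right x)"
proof -
  have "(f \<longlongrightarrow> f x) (at_left x) \<and> (f \<longlongrightarrow> f x) (at_right x)" if "isCont f x"
    using that by (auto simp: isCont_def intro: filterlim_at_split[THEN iffD1, THEN conjunct1]
        filterlim_at_split[THEN iffD1, THEN conjunct2])
  thus "\<exists>l. (f \<longlongrightarrow> l) (at_left x)" "\<exists>l. (f \<longlongrightarrow> l) (at_right x)"
    using assms by (auto simp: piecewise_continuous_def)
qed

text \<open>Common source of closure under sums and products. The limit hypothesis quantifies over
  all filters so that it covers the approach from the left and from the right.\<close>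

lemma piecewise_continuous_combine:
  assumes f: "piecewise_continuous f" and g: "piecewise_continuous g"
    and cont: "\<And>x. isCont f x \<Longrightarrow> isCont g x \<Longrightarrow> isCont h x"
    and lim: "\<And>F a b. (f \<longlongrightarrow> a) F \<Longrightarrow> (g \<longlongrightarrow> b) F \<Longrightarrow> \<exists>c. (h \<longlongrightarrow> c) F"
  shows "piecewise_continuous h"
  unfolding piecewise_continuous_def
proof (intro conjI allI impI)
  fix a b
  have "{x \<in> {a..b}. \<not> isCont h x} \<subseteq> {x \<in> {a..b}. \<not> isCont f x} \<union> {x \<in> {a..b}. \<not> isCont g x}"
    using cont by auto
  thus "finite {x \<in> {a..b}. \<not> isCont h x}"
    using f g by (rule_tac finite_subset) (auto simp: piecewise_continuous_def)
qed (use piecewise_continuous_limits[OF f] piecewise_continuous_limits[OF g] lim in blast)+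

lemma piecewise_continuous_add:
  assumes "piecewise_continuous f" "piecewise_continuous g"
  shows "piecewise_continuous (\<lambda>x. f x + g x)"
  using assms by (rule piecewise_continuous_combine) (auto intro: tendsto_add)

lemma piecewise_continuous_mult:
  assumes "piecewise_continuous f" "piecewise_continuous g"
  shows "piecewise_continuous (\<lambda>x. f x * g x)"
  using assms by (rule piecewise_continuous_combine) (auto intro: tendsto_mult)

lemma piecewise_continuous_continuous:
  assumes "continuous_on UNIV f"
  shows "piecewise_continuous f"
  using assms by (auto simp: piecewise_continuous_def continuous_on_eq_continuous_at)

section \<open>Unit cells as level sets of the floor function, and cutting the core to cells\<close>

lemma mem_unit_cell_iff: "x \<in> unit_cell k \<longleftrightarrow> \<lfloor>x\<rfloor> = k"
  by (auto simp: unit_cell_def floor_eq_iff)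

lemma indicator_cells: "indicator (\<Union>k\<in>\<Delta>. unit_cell k) x = indicator \<Delta> \<lfloor>x\<rfloor>"
  by (auto simp: mem_unit_cell_iff indicator_def)

text \<open>The function depends on the floor of x alone, hence is locally constant off the
  integers. Even for infinite \<open>\<Delta>\<close> a compact interval meets finitely many
  possible jumps.\<close>

lemma piecewise_continuous_indicator_cells:
  "piecewise_continuous (indicator (\<Union>k\<in>\<Delta>. unit_cell k))"
proof -
  let ?f = "indicator (\<Union>k\<in>\<Delta>. unit_cell k) :: real \<Rightarrow> complex"
  have const: "?f y = ?f z" if "\<lfloor>y\<rfloor> = \<lfloor>z\<rfloor>" for y z
    by (simp add: indicator_cells that)
  have cont: "x = of_int \<lfloor>x\<rfloor>" if "\<not> isCont ?f x" for x
  proof (rule ccontr)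
    assume "x \<noteq> of_int \<lfloor>x\<rfloor>"
    hence "x \<in> {of_int \<lfloor>x\<rfloor><..<of_int \<lfloor>x\<rfloor> + 1}"
      using floor_correct[of x] by (auto simp: less_le)
    hence "\<forall>\<^sub>F y in nhds x. y \<in> {of_int \<lfloor>x\<rfloor><..<of_int \<lfloor>x\<rfloor> + 1}"
      by (intro eventually_nhds_in_open) auto
    hence "\<forall>\<^sub>F y in nhds x. ?f y = ?f x"
      by eventually_elim (rule const, simp add: floor_eq_iff)
    hence "isCont ?f x \<longleftrightarrow> isCont (\<lambda>_. ?f x) x" by (rule isCont_cong)
    thus False using that by simp
  qed
  show ?thesis
    unfolding piecewise_continuous_def
  proof (intro conjI allI impI)
    fix a b
    have "{x \<in> {a..b}. \<not> isCont ?f x} \<subseteq> of_int ` {\<lfloor>a\<rfloor>..\<lfloor>b\<rfloor>}"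
      using cont by (fastforce intro: floor_mono)
    thus "finite {x \<in> {a..b}. \<not> isCont ?f x}" by (rule finite_subset) simp
  next
    fix x :: real
    \<comment> \<open>The largest integer strictly below x is its ceiling minus 1, so this interval
      stays in a single cell also when x is an integer.\<close>
    have "\<forall>\<^sub>F y in at_left x. y \<in> {of_int (\<lceil>x\<rceil> - 1)<..<x}"
      using ceiling_correct[of x] by (intro eventually_at_left_real) simp
    hence "\<forall>\<^sub>F y in at_left x. ?f y = ?f (of_int (\<lceil>x\<rceil> - 1))"
    proof eventually_elim
      case (elim y)
      have "x \<le> of_int \<lceil>x\<rceil>" by (rule le_of_int_ceiling)
      with elim have "y < of_int \<lceil>x\<rceil>" unfolding greaterThanLessThan_iff by linarith
      hence "\<lfloor>y\<rfloor> = \<lceil>x\<rceil> - 1" using elim by (simp add: floor_eq_iff)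
      thus ?case by (intro const) simp
    qed
    thus "\<exists>l. (?f \<longlongrightarrow> l) (at_left x)" by (blast intro: tendsto_eventually)
    have "\<forall>\<^sub>F y in at_right x. y \<in> {x<..<of_int \<lfloor>x\<rfloor> + 1}"
      by (intro eventually_at_right_real) linarith
    hence "\<forall>\<^sub>F y in at_right x. ?f y = ?f x"
    proof eventually_elim
      case (elim y)
      have "of_int \<lfloor>x\<rfloor> \<le> x" by (rule of_int_floor_le)
      with elim have "of_int \<lfloor>x\<rfloor> \<le> y" unfolding greaterThanLessThan_iff by linarith
      hence "\<lfloor>y\<rfloor> = \<lfloor>x\<rfloor>" using elim by (simp add: floor_eq_iff)
      thus ?case by (rule const)
    qed
    thus "\<exists>l. (?f \<longlongrightarrow> l) (at_right x)" by (blast intro: tendsto_eventually)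
  qed
qed

text \<open>On the line a closure is compact exactly if the set is bounded; boundedness passes
  directly to subsets and finite unions of supports.\<close>

lemma pc_domainI:
  assumes "piecewise_continuous f" "bounded {x. f x \<noteq> 0}" "AE x in lborel. rep_L2 \<Phi> x = f x"
  shows "\<Phi> \<in> pc_domain"
  using assms by (auto simp: pc_domain_def compact_closure)

lemma pc_domainE:
  assumes "\<Phi> \<in> pc_domain"
  obtains f where "piecewise_continuous f" "bounded {x. f x \<noteq> 0}" "AE x in lborel. rep_L2 \<Phi> x = f x"
  using assms by (auto simp: pc_domain_def compact_closure)

lemma csubspace_pc_domain: "csubspace pc_domain"
  unfolding csubspace_def
proof (intro conjI ballI allI)
  show "0 \<in> pc_domain"
    by (rule pc_domainI[of "\<lambda>x. 0"]) (auto simp: AE_rep_zero intro: piecewise_continuous_continuous)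
  fix \<Phi> assume "\<Phi> \<in> pc_domain"
  then obtain f where f: "piecewise_continuous f" "bounded {x. f x \<noteq> 0}" "AE x in lborel. rep_L2 \<Phi> x = f x"
    by (rule pc_domainE)
  { fix \<Psi> assume "\<Psi> \<in> pc_domain"
    then obtain g where g: "piecewise_continuous g" "bounded {x. g x \<noteq> 0}" "AE x in lborel. rep_L2 \<Psi> x = g x"
      by (rule pc_domainE)
    show "\<Phi> + \<Psi> \<in> pc_domain"
    proof (rule pc_domainI)
      show "piecewise_continuous (\<lambda>x. f x + g x)" by (intro piecewise_continuous_add f g)
      show "bounded {x. f x + g x \<noteq> 0}"
        by (rule bounded_subset[of "{x. f x \<noteq> 0} \<union> {x. g x \<noteq> 0}"]) (use f g in auto)
      show "AE x in lborel. rep_L2 (\<Phi> + \<Psi>) x = f x + g x"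
        using AE_rep_add[of \<Phi> \<Psi>] f(3) g(3) by eventually_elim simp
    qed }
  show "c *\<^sub>C \<Phi> \<in> pc_domain" for c
  proof (rule pc_domainI)
    show "piecewise_continuous (\<lambda>x. c * f x)"
      by (intro piecewise_continuous_mult f piecewise_continuous_continuous continuous_on_const)
    show "bounded {x. c * f x \<noteq> 0}" by (rule bounded_subset[OF f(2)]) auto
    show "AE x in lborel. rep_L2 (c *\<^sub>C \<Phi>) x = c * f x"
      using AE_rep_scaleC[of c \<Phi>] f(3) by eventually_elim simp
  qed
qed

lemma cell_proj_pc_domain:
  assumes "\<Phi> \<in> pc_domain"
  shows "cell_proj \<Delta> \<Phi> \<in> pc_domain"
proof -
  obtain f where f: "piecewise_continuous f" "bounded {x. f x \<noteq> 0}" "AE x in lborel. rep_L2 \<Phi> x = f x"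
    using assms by (rule pc_domainE)
  show ?thesis
  proof (rule pc_domainI)
    show "piecewise_continuous (\<lambda>x. indicator (\<Union>k\<in>\<Delta>. unit_cell k) x * f x)"
      by (intro piecewise_continuous_mult f piecewise_continuous_indicator_cells)
    show "bounded {x. indicator (\<Union>k\<in>\<Delta>. unit_cell k) x * f x \<noteq> 0}"
      by (rule bounded_subset[OF f(2)]) auto
    show "AE x in lborel. rep_L2 (cell_proj \<Delta> \<Phi>) x = indicator (\<Union>k\<in>\<Delta>. unit_cell k) x * f x"
      using AE_rep_restrict[OF sets_cells, of \<Delta> \<Phi>] f(3) unfolding cell_proj_def
      by eventually_elim simp
  qed
qed

section \<open>Approximation in weighted L2 spaces\<close>

lemma continuous_on_bounded_interval:
  fixes w :: "real \<Rightarrow> real"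
  assumes "continuous_on UNIV w"
  shows "\<exists>C. \<forall>x\<in>{a..b}. \<bar>w x\<bar> \<le> C"
proof -
  have "compact (w ` {a..b})"
    by (intro compact_continuous_image continuous_on_subset[OF assms]) auto
  hence "bounded (w ` {a..b})" by (rule compact_imp_bounded)
  thus ?thesis by (simp add: bounded_iff)
qed

text \<open>Formulated for any class supported in an interval, so that it covers cut-offs of
  arbitrary elements as well as the core.\<close>

lemma compact_support_weighted_domain:
  assumes supp: "AE x in lborel. rep_L2 \<Phi> x \<noteq> 0 \<longrightarrow> x \<in> {-r..r}"
    and w: "continuous_on UNIV w"
  shows "\<Phi> \<in> weighted_domain w"
proof -
  have [measurable]: "w \<in> borel_measurable borel"
    using w by (rule borel_measurable_continuous_onI)
  obtain C where C: "\<And>x. x \<in> {-r..r} \<Longrightarrow> \<bar>w x\<bar> \<le> C"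
    using continuous_on_bounded_interval[OF w] by blast
  have "integrable lborel (\<lambda>x. w x * (cmod (rep_L2 \<Phi> x))\<^sup>2)"
  proof (rule Bochner_Integration.integrable_bound)
    show "integrable lborel (\<lambda>x. C * (cmod (rep_L2 \<Phi> x))\<^sup>2)"
      by (intro integrable_mult_right integrable_rep_sq)
    show "AE x in lborel. norm (w x * (cmod (rep_L2 \<Phi> x))\<^sup>2) \<le> norm (C * (cmod (rep_L2 \<Phi> x))\<^sup>2)"
      using supp
    proof eventually_elim
      case (elim x)
      show ?case
      proof (cases "rep_L2 \<Phi> x = 0")
        case False
        hence "\<bar>w x\<bar> \<le> \<bar>C\<bar>" using C elim by fastforce
        thus ?thesis by (auto simp: abs_mult intro!: mult_right_mono)
      qed simp
    qed
  qed measurable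
  thus ?thesis by (simp add: weighted_domain_def)
qed

lemma pc_domain_weighted_domain:
  assumes "\<Phi> \<in> pc_domain" "continuous_on UNIV w"
  shows "\<Phi> \<in> weighted_domain w"
proof -
  obtain f where f: "bounded {x. f x \<noteq> 0}" "AE x in lborel. rep_L2 \<Phi> x = f x"
    using assms(1) by (rule pc_domainE)
  then obtain r where r: "\<And>x. f x \<noteq> 0 \<Longrightarrow> \<bar>x\<bar> \<le> r" by (auto simp: bounded_iff)
  have "AE x in lborel. rep_L2 \<Phi> x \<noteq> 0 \<longrightarrow> x \<in> {-r..r}"
    using f(2) by eventually_elim (use r in \<open>fastforce simp: abs_le_iff\<close>)
  thus ?thesis using assms(2) by (rule compact_support_weighted_domain)
qed

text \<open>A bounded measurable function supported in an interval is an almost everywhere limit of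
  continuous functions; projecting these to a disc and cutting them off gives a dominated sequence.\<close>

lemma bounded_approx_pc:
  fixes f :: "real \<Rightarrow> complex" and N :: nat
  assumes f: "f \<in> borel_measurable borel" "\<And>x. cmod (f x) \<le> N"
    and supp: "\<And>x. f x \<noteq> 0 \<Longrightarrow> x \<in> {- real N..<real N}"
    and w: "continuous_on UNIV w" "\<And>x. 0 \<le> w x" and "\<epsilon> > 0"
  obtains h where "sq_integrable h" "piecewise_continuous h" "bounded {x. h x \<noteq> 0}"
    "integrable lborel (\<lambda>x. w x * (cmod (f x - h x))\<^sup>2)"
    "(LINT x|lborel. w x * (cmod (f x - h x))\<^sup>2) < \<epsilon>"
proof -
  note f(1) [measurable]
  have [measurable]: "w \<in> borel_measurable borel"
    using w(1) by (rule borel_measurable_continuous_onI)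
  \<comment> \<open>This notion of measurability is by definition the existence of continuous
    functions converging to f off a negligible set; it supplies the approximants
    \<open>g n\<close>.\<close>
  have "f measurable_on UNIV"
    by (rule lebesgue_measurable_imp_measurable_on) (use f(1) in \<open>auto intro: measurable_completion\<close>)
  then obtain Z g where Z: "negligible Z" and g: "\<And>n. continuous_on UNIV (g n)"
    "\<And>x. x \<notin> Z \<Longrightarrow> (\<lambda>n. g n x) \<longlonglongrightarrow> f x"
    unfolding measurable_on_def by auto
  \<comment> \<open>The half-open interval from -N to N, written as a union of cells because
    indicators of such unions are already known to be piecewise continuous.\<close>
  define U where "U = (\<Union>k\<in>{- int N..<int N}. unit_cell k)"
  have U_iff: "x \<in> U \<longleftrightarrow> x \<in> {- real N..<real N}" for x
    by (auto simp: U_def mem_unit_cell_iff le_floor_iff floor_less_iff)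
  \<comment> \<open>A continuous retraction onto the disc of radius N. It fixes the values of f, so
    it bounds the approximants without disturbing their convergence.\<close>
  define c where "c = closest_point (cball (0::complex) N)"
  have c: "continuous_on S c" for S
    unfolding c_def by (intro continuous_on_closest_point) auto
  have cN: "cmod (c z) \<le> N" for z
    using closest_point_in_set[of "cball (0::complex) N" z] by (simp add: c_def)
  have cf: "c (f x) = f x" for x
    unfolding c_def using f(2) by (intro closest_point_self) simp
  define h where "h n x = indicator U x * c (g n x)" for n x
  have cg: "continuous_on UNIV (\<lambda>x. c (g n x))" for n
    using continuous_on_compose[OF g(1) c] by (simp add: o_def)
  have [measurable]: "U \<in> sets borel" "(\<lambda>x. c (g n x)) \<in> borel_measurable borel" for n
    using borel_measurable_continuous_onI[OF cg] by (simp_all add: U_def)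
  have hm [measurable]: "h n \<in> borel_measurable borel" for n
    unfolding h_def by measurable
  have hN: "cmod (h n x) \<le> N" for n x
    using cN by (simp add: h_def norm_mult split: split_indicator)
  have h0: "h n x = 0" "f x = 0" if "x \<notin> U" for n x
    using that supp by (auto simp: h_def U_iff)
  have int_ind: "integrable lborel (\<lambda>x. K * indicator {- real N..real N} x)" for K :: real
    by (intro integrable_mult_right integrable_real_indicator) auto
  have le_ind: "a \<le> K * indicator {- real N..real N} x"
    if "x \<in> U \<Longrightarrow> a \<le> K" "x \<notin> U \<Longrightarrow> a = 0" "0 \<le> K" for a K :: real and x
    using that by (auto simp: U_iff split: split_indicator)
  have sq: "sq_integrable (h n)" for n
    unfolding sq_integrable_def
  proof
    show "integrable lborel (\<lambda>x. (cmod (h n x))\<^sup>2)"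
    proof (rule Bochner_Integration.integrable_bound[OF int_ind[of "(real N)\<^sup>2"]])
      show "AE x in lborel. norm ((cmod (h n x))\<^sup>2) \<le> norm ((real N)\<^sup>2 * indicator {- real N..real N} x)"
        using hN h0 by (intro AE_I2) (auto simp: abs_mult intro!: le_ind power_mono)
    qed measurable
  qed simp
  have pc: "piecewise_continuous (h n)" for n
    unfolding h_def U_def
    by (intro piecewise_continuous_mult piecewise_continuous_indicator_cells
        piecewise_continuous_continuous cg)
  have bd: "bounded {x. h n x \<noteq> 0}" for n
    by (rule bounded_subset[of "{- real N..real N}"]) (use h0 U_iff in fastforce)+
  obtain C where C: "\<And>x. x \<in> {- real N..real N} \<Longrightarrow> \<bar>w x\<bar> \<le> C"
    using continuous_on_bounded_interval[OF w(1)] by blast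
  have C0: "0 \<le> C" using C[of 0] by simp
  \<comment> \<open>C bounds the weight on the interval, and |f - h| \<le> 2 N since both values lie
    in the disc.\<close>
  define K where "K = C * (2 * real N)\<^sup>2"
  have dom: "norm (w x * (cmod (f x - h n x))\<^sup>2) \<le> K * indicator {- real N..real N} x" for x n
  proof (rule le_ind)
    assume "x \<in> U"
    hence "w x \<le> C" using C[of x] by (auto simp: U_iff)
    moreover have "cmod (f x - h n x) \<le> 2 * real N"
      using norm_triangle_ineq4[of "f x" "h n x"] f(2)[of x] hN[of n x] by simp
    hence "(cmod (f x - h n x))\<^sup>2 \<le> (2 * real N)\<^sup>2" by (rule power_mono) simp
    ultimately show "norm (w x * (cmod (f x - h n x))\<^sup>2) \<le> K"
      using w(2)[of x] C0 by (simp add: K_def abs_mult mult_mono)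
  qed (use C0 h0 in \<open>auto simp: K_def\<close>)
  have int: "integrable lborel (\<lambda>x. w x * (cmod (f x - h n x))\<^sup>2)" for n
  proof (rule Bochner_Integration.integrable_bound[OF int_ind[of K]])
    show "AE x in lborel. norm (w x * (cmod (f x - h n x))\<^sup>2) \<le> norm (K * indicator {- real N..real N} x)"
      using dom by (intro AE_I2) (metis norm_ge_zero abs_of_nonneg order_trans real_norm_def)
  qed measurable
  have "(\<lambda>n. LINT x|lborel. w x * (cmod (f x - h n x))\<^sup>2) \<longlonglongrightarrow> (LINT x::real|lborel. (0::real))"
  proof (rule integral_dominated_convergence)
    have "AE x in lborel. x \<notin> Z"
      using Z AE_not_in[of Z lebesgue] by (simp add: negligible_iff_null_sets AE_completion_iff)
    thus "AE x in lborel. (\<lambda>n. w x * (cmod (f x - h n x))\<^sup>2) \<longlonglongrightarrow> 0"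
    proof eventually_elim
      case (elim x)
      have "(\<lambda>n. c (g n x)) \<longlonglongrightarrow> c (f x)"
        using continuous_on_tendsto_compose[OF c[of UNIV] g(2)[OF elim]] by simp
      hence "(\<lambda>n. w x * (cmod (f x - h n x))\<^sup>2) \<longlonglongrightarrow> w x * (cmod (f x - indicator U x * f x))\<^sup>2"
        unfolding h_def cf by (intro tendsto_intros)
      moreover have "indicator U x * f x = f x" using h0(2)[of x] by (auto split: split_indicator)
      ultimately show ?case by simp
    qed
    show "AE x in lborel. norm (w x * (cmod (f x - h n x))\<^sup>2) \<le> K * indicator {- real N..real N} x" for n
      using dom by simp
    show "integrable lborel (\<lambda>x. K * indicator {- real N..real N} x)" by (rule int_ind)
  qed measurable
  hence "\<forall>\<^sub>F n in sequentially. (LINT x|lborel. w x * (cmod (f x - h n x))\<^sup>2) < \<epsilon>"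
    using \<open>\<epsilon> > 0\<close> by (intro order_tendstoD) auto
  then obtain n where "(LINT x|lborel. w x * (cmod (f x - h n x))\<^sup>2) < \<epsilon>"
    by (auto simp: eventually_sequentially)
  thus thesis using that[OF sq pc bd int] by blast
qed

text \<open>Cutting off in position and in height makes the function bounded with bounded support;
  its error is dominated by w |\<Phi>|^2. Approximating the truncated function adds a second error.
  Each is below \<epsilon>/4, and the inequality for squared sums doubles both.\<close>

lemma pc_domain_dense:
  assumes \<Phi>: "\<Phi> \<in> weighted_domain w"
    and w: "continuous_on UNIV w" "\<And>x. 0 \<le> w x" and "\<epsilon> > 0"
  obtains \<Psi> where "\<Psi> \<in> pc_domain" "(LINT x|lborel. w x * (cmod (rep_L2 (\<Phi> - \<Psi>) x))\<^sup>2) < \<epsilon>"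
proof -
  have [measurable]: "w \<in> borel_measurable borel"
    using w(1) by (rule borel_measurable_continuous_onI)
  let ?r = "rep_L2 \<Phi>"
  define S where "S N = {x. x \<in> {- real N..<real N} \<and> cmod (?r x) \<le> N}" for N
  have Sm [measurable]: "S N \<in> sets borel" for N
  proof -
    have "S N = {x \<in> space borel. x \<in> {- real N..<real N} \<and> cmod (?r x) \<le> N}" by (simp add: S_def)
    also have "\<dots> \<in> sets borel" by measurable
    finally show ?thesis .
  qed
  define f where "f N x = indicator (S N) x * ?r x" for N x
  have fm [measurable]: "f N \<in> borel_measurable borel" for N unfolding f_def by measurable
  have dom: "norm (w x * (cmod (?r x - f N x))\<^sup>2) \<le> w x * (cmod (?r x))\<^sup>2" for x N
    using w(2)[of x] by (auto simp: f_def split: split_indicator)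
  have intw: "integrable lborel (\<lambda>x. w x * (cmod (?r x))\<^sup>2)"
    using \<Phi> by (simp add: weighted_domain_def)
  have int: "integrable lborel (\<lambda>x. w x * (cmod (?r x - f N x))\<^sup>2)" for N
  proof (rule Bochner_Integration.integrable_bound[OF intw])
    show "AE x in lborel. norm (w x * (cmod (?r x - f N x))\<^sup>2) \<le> norm (w x * (cmod (?r x))\<^sup>2)"
      using dom[of _ N] w(2) by (intro AE_I2) simp
  qed measurable
  have "(\<lambda>N. LINT x|lborel. w x * (cmod (?r x - f N x))\<^sup>2) \<longlonglongrightarrow> (LINT x::real|lborel. (0::real))"
  proof (rule integral_dominated_convergence)
    show "AE x in lborel. (\<lambda>N. w x * (cmod (?r x - f N x))\<^sup>2) \<longlonglongrightarrow> 0"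
    proof (rule AE_I2)
      fix x
      \<comment> \<open>The \<open>+ 1\<close> keeps x away from the right endpoint, which the
        half-open interval excludes.\<close>
      obtain M :: nat where M: "max (\<bar>x\<bar> + 1) (cmod (?r x)) \<le> real M" using real_arch_simple by blast
      have "w x * (cmod (?r x - f N x))\<^sup>2 = 0" if "N \<ge> M" for N
      proof -
        have "real M \<le> real N" using that by simp
        hence "x \<in> S N" using M by (auto simp: S_def)
        thus ?thesis by (simp add: f_def)
      qed
      hence "\<forall>\<^sub>F N in sequentially. w x * (cmod (?r x - f N x))\<^sup>2 = 0"
        by (rule eventually_sequentiallyI)
      thus "(\<lambda>N. w x * (cmod (?r x - f N x))\<^sup>2) \<longlonglongrightarrow> 0" by (rule tendsto_eventually)
    qed
    show "AE x in lborel. norm (w x * (cmod (?r x - f N x))\<^sup>2) \<le> w x * (cmod (?r x))\<^sup>2" for N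
      using dom by simp
  qed (use intw in measurable)
  hence "\<forall>\<^sub>F N in sequentially. (LINT x|lborel. w x * (cmod (?r x - f N x))\<^sup>2) < \<epsilon> / 4"
    using \<open>\<epsilon> > 0\<close> by (intro order_tendstoD) auto
  then obtain N where N: "(LINT x|lborel. w x * (cmod (?r x - f N x))\<^sup>2) < \<epsilon> / 4"
    by (auto simp: eventually_sequentially)
  have fN: "cmod (f N x) \<le> N" "f N x \<noteq> 0 \<Longrightarrow> x \<in> {- real N..<real N}" for x
    by (auto simp: f_def S_def split: split_indicator split_indicator_asm)
  obtain h where h: "sq_integrable h" "piecewise_continuous h" "bounded {x. h x \<noteq> 0}"
    "integrable lborel (\<lambda>x. w x * (cmod (f N x - h x))\<^sup>2)"
    "(LINT x|lborel. w x * (cmod (f N x - h x))\<^sup>2) < \<epsilon> / 4"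
    by (rule bounded_approx_pc[OF fm fN w, of "\<epsilon> / 4"]) (use \<open>\<epsilon> > 0\<close> in simp_all)
  show thesis
  proof
    show pc: "abs_L2 h \<in> pc_domain" by (intro pc_domainI[OF h(2,3)] AE_rep_abs h)
    have ae: "AE x in lborel. w x * (cmod (rep_L2 (\<Phi> - abs_L2 h) x))\<^sup>2
        \<le> 2 * (w x * (cmod (?r x - f N x))\<^sup>2) + 2 * (w x * (cmod (f N x - h x))\<^sup>2)"
      using AE_rep_minus[of \<Phi> "abs_L2 h"] AE_rep_abs[OF h(1)]
    proof eventually_elim
      case (elim x)
      have "w x * (cmod ((?r x - f N x) + (f N x - h x)))\<^sup>2
          \<le> w x * (2 * (cmod (?r x - f N x))\<^sup>2 + 2 * (cmod (f N x - h x))\<^sup>2)"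
        by (intro mult_left_mono norm_add_square_le w)
      thus ?case by (simp add: elim algebra_simps)
    qed
    have int2: "integrable lborel (\<lambda>x. 2 * (w x * (cmod (?r x - f N x))\<^sup>2)
        + 2 * (w x * (cmod (f N x - h x))\<^sup>2))"
      by (intro Bochner_Integration.integrable_add integrable_mult_right int h)
    have "(LINT x|lborel. w x * (cmod (rep_L2 (\<Phi> - abs_L2 h) x))\<^sup>2)
        \<le> (LINT x|lborel. 2 * (w x * (cmod (?r x - f N x))\<^sup>2) + 2 * (w x * (cmod (f N x - h x))\<^sup>2))"
      by (rule integral_mono_AE'[OF int2 ae]) (use w(2) in auto)
    also have "\<dots> = 2 * (LINT x|lborel. w x * (cmod (?r x - f N x))\<^sup>2)
        + 2 * (LINT x|lborel. w x * (cmod (f N x - h x))\<^sup>2)"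
      by (simp add: int h)
    also have "\<dots> < \<epsilon>" using N h(5) by simp
    finally show "(LINT x|lborel. w x * (cmod (rep_L2 (\<Phi> - abs_L2 h) x))\<^sup>2) < \<epsilon>" .
  qed
qed

lemma closure_pc_domain: "closure pc_domain = UNIV"
proof -
  have "\<exists>\<Psi>\<in>pc_domain. dist \<Psi> \<Phi> < e" if e: "e > 0" for \<Phi> and e :: real
  proof -
    \<comment> \<open>With the constant weight 1, weighted density is density in norm.\<close>
    have "\<Phi> \<in> weighted_domain (\<lambda>x. 1)" by (simp add: weighted_domain_def integrable_rep_sq)
    then obtain \<Psi> where \<Psi>: "\<Psi> \<in> pc_domain" "(LINT x|lborel. 1 * (cmod (rep_L2 (\<Phi> - \<Psi>) x))\<^sup>2) < e\<^sup>2"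
      by (rule pc_domain_dense[of _ _ "e\<^sup>2"]) (use e in simp_all)
    have "(norm (\<Phi> - \<Psi>))\<^sup>2 < e\<^sup>2" using \<Psi>(2) by (simp add: norm_L2_sq)
    hence "norm (\<Phi> - \<Psi>) < e" using e by (simp add: power2_less_imp_less)
    thus ?thesis using \<Psi>(1) by (auto simp: dist_norm norm_minus_commute)
  qed
  thus ?thesis by (auto simp: closure_approachable)
qed

section \<open>Self-adjointness and strong representability\<close>

lemma csubspace_Int: "csubspace S \<Longrightarrow> csubspace T \<Longrightarrow> csubspace (S \<inter> T)"
  by (auto simp: csubspace_def)

lemma csubspace_diff:
  assumes "csubspace S" "x \<in> S" "y \<in> S"
  shows "x - y \<in> S"
proof -
  have "x - y = x + complex_of_real (-1) *\<^sub>C y"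
    unfolding scaleR_scaleC [symmetric] by simp
  thus ?thesis using assms unfolding csubspace_def by metis
qed

lemma restrict_interval_position_dom:
  "restrict_L2 {-r..r} \<Phi> \<in> position_dom"
  unfolding position_dom_eq
proof (rule compact_support_weighted_domain)
  show "AE x in lborel. rep_L2 (restrict_L2 {-r..r} \<Phi>) x \<noteq> 0 \<longrightarrow> x \<in> {-r..r}"
    using AE_rep_restrict[of "{-r..r}" \<Phi>, simplified] by eventually_elim (auto split: split_indicator)
qed (intro continuous_intros)

text \<open>Testing against the cut-off of \<open>x \<Psi> - \<eta>\<close> to \<open>[-r, r]\<close>, which lies in the domain, identifies
  the adjoint.\<close>

lemma adjoint_position_op:
  assumes A: "A \<in> sets borel" and \<Psi>: "\<Psi> \<in> L2_on A" and \<eta>: "\<eta> \<in> L2_on A"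
    and adj: "\<And>\<Phi>. \<Phi> \<in> L2_on A \<inter> position_dom \<Longrightarrow> cinner \<Psi> (position_op \<Phi>) = cinner \<eta> \<Phi>"
  shows "\<Psi> \<in> position_dom" and "\<eta> = position_op \<Psi>"
proof -
  have ae: "AE x in lborel. x \<in> {- real n..real n} \<longrightarrow> rep_L2 \<eta> x = complex_of_real x * rep_L2 \<Psi> x" for n
  proof -
    let ?I = "{- real n..real n}"
    have \<Psi>D: "restrict_L2 ?I \<Psi> \<in> position_dom" by (rule restrict_interval_position_dom)
    \<comment> \<open>The cut-off precedes the operator because \<open>\<Psi>\<close> is not yet
      known to lie in its domain.\<close>
    define \<Xi> where "\<Xi> = position_op (restrict_L2 ?I \<Psi>) - restrict_L2 ?I \<eta>"
    have \<Xi>: "AE x in lborel. rep_L2 \<Xi> x = indicator ?I x * (complex_of_real x * rep_L2 \<Psi> x - rep_L2 \<eta> x)"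
      using AE_rep_minus[of "position_op (restrict_L2 ?I \<Psi>)" "restrict_L2 ?I \<eta>"]
        AE_rep_position_op[OF \<Psi>D] AE_rep_restrict[of ?I \<Psi>, simplified] AE_rep_restrict[of ?I \<eta>, simplified]
      unfolding \<Xi>_def by eventually_elim (simp add: algebra_simps)
    have "AE x in lborel. rep_L2 (restrict_L2 ?I \<Xi>) x = rep_L2 \<Xi> x"
      using \<Xi> AE_rep_restrict[of ?I \<Xi>, simplified] by eventually_elim (auto split: split_indicator)
    hence "restrict_L2 ?I \<Xi> = \<Xi>" by (rule L2_eqI)
    hence \<Xi>D: "\<Xi> \<in> position_dom" using restrict_interval_position_dom[of "real n" \<Xi>] by simp
    have "AE x in lborel. x \<notin> A \<longrightarrow> rep_L2 \<Xi> x = 0"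
      using \<Xi> \<Psi>[unfolded L2_on_def, simplified] \<eta>[unfolded L2_on_def, simplified]
      by eventually_elim auto
    hence \<Xi>A: "\<Xi> \<in> L2_on A" by (simp add: L2_on_def)
    \<comment> \<open>On the interval the conjugate of \<Xi> is that of x \<Psi> - \<eta>, and the
      real factor x moves over to \<Xi>. Off the interval both sides vanish. What results is the
      adjoint relation tested on \<Xi>, so \<Xi> = 0.\<close>
    have "cinner \<Xi> \<Xi> = (LINT x|lborel. cnj (rep_L2 \<Psi> x) * rep_L2 (position_op \<Xi>) x
        - cnj (rep_L2 \<eta> x) * rep_L2 \<Xi> x)"
      unfolding cinner_L2_def
    proof (rule integral_cong_AE)
      show "AE x in lborel. cnj (rep_L2 \<Xi> x) * rep_L2 \<Xi> x
          = cnj (rep_L2 \<Psi> x) * rep_L2 (position_op \<Xi>) x - cnj (rep_L2 \<eta> x) * rep_L2 \<Xi> x"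
        using \<Xi> AE_rep_position_op[OF \<Xi>D]
      proof eventually_elim
        case (elim x)
        show ?case
        proof (cases "x \<in> ?I")
          case True
          hence "rep_L2 \<Xi> x = complex_of_real x * rep_L2 \<Psi> x - rep_L2 \<eta> x" using elim(1) by simp
          hence "cnj (rep_L2 \<Xi> x) = complex_of_real x * cnj (rep_L2 \<Psi> x) - cnj (rep_L2 \<eta> x)" by simp
          thus ?thesis unfolding elim(2) by (simp only:) (simp add: algebra_simps)
        qed (use elim in simp)
      qed
    qed measurable
    also have "\<dots> = cinner \<Psi> (position_op \<Xi>) - cinner \<eta> \<Xi>"
      unfolding cinner_L2_def by (intro Bochner_Integration.integral_diff integrable_rep_prod)
    also have "\<dots> = 0" using adj \<Xi>A \<Xi>D by simp
    finally have "inner \<Xi> \<Xi> = 0" by (simp add: inner_eq_Re_cinner)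
    hence "AE x in lborel. rep_L2 \<Xi> x = 0" using AE_rep_zero by simp
    with \<Xi> show ?thesis
    proof eventually_elim
      case (elim x)
      thus ?case by (metis indicator_simps(1) lambda_one mult_1 right_minus_eq)
    qed
  qed
  \<comment> \<open>Integer radii suffice to cover the line, and their countably many null sets can
    be united.\<close>
  have "AE x in lborel. \<forall>n. x \<in> {- real n..real n} \<longrightarrow> rep_L2 \<eta> x = complex_of_real x * rep_L2 \<Psi> x"
    unfolding AE_all_countable using ae by blast
  hence eq: "AE x in lborel. rep_L2 \<eta> x = complex_of_real x * rep_L2 \<Psi> x"
  proof eventually_elim
    case (elim x)
    obtain n :: nat where "\<bar>x\<bar> \<le> real n" using real_arch_simple by blast
    thus ?case using elim by (auto simp: abs_le_iff)
  qed
  have "integrable lborel (\<lambda>x. x\<^sup>2 * (cmod (rep_L2 \<Psi> x))\<^sup>2) \<longleftrightarrow> integrable lborel (\<lambda>x. (cmod (rep_L2 \<eta> x))\<^sup>2)"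
  proof (rule integrable_cong_AE)
    show "AE x in lborel. x\<^sup>2 * (cmod (rep_L2 \<Psi> x))\<^sup>2 = (cmod (rep_L2 \<eta> x))\<^sup>2"
      using eq by eventually_elim (simp add: norm_mult power_mult_distrib)
  qed measurable
  thus \<Psi>D: "\<Psi> \<in> position_dom" by (simp add: position_dom_def integrable_rep_sq)
  show "\<eta> = position_op \<Psi>"
    by (rule L2_eqI, use eq AE_rep_position_op[OF \<Psi>D] in eventually_elim) simp
qed

lemma position_op_symmetric:
  assumes "\<Phi> \<in> position_dom" "\<Psi> \<in> position_dom"
  shows "cinner \<Psi> (position_op \<Phi>) = cinner (position_op \<Psi>) \<Phi>"
  unfolding cinner_L2_def
  by (rule integral_cong_AE, measurable,
      use AE_rep_position_op[OF assms(1)] AE_rep_position_op[OF assms(2)] in eventually_elim) simp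

lemma clinear_on_position_op: "clinear_on position_dom position_op"
proof -
  have sub: "csubspace position_dom"
    unfolding position_dom_eq by (rule csubspace_weighted_domain) auto
  show ?thesis
    unfolding clinear_on_def
  proof (intro conjI ballI allI)
    fix \<Phi> \<Psi> c assume \<Phi>: "\<Phi> \<in> position_dom"
    { assume \<Psi>: "\<Psi> \<in> position_dom"
      have "\<Phi> + \<Psi> \<in> position_dom" using sub \<Phi> \<Psi> by (simp add: csubspace_def)
      from AE_rep_position_op[OF this] AE_rep_position_op[OF \<Phi>] AE_rep_position_op[OF \<Psi>]
        AE_rep_add[of \<Phi> \<Psi>] AE_rep_add[of "position_op \<Phi>" "position_op \<Psi>"]
      have "AE x in lborel. rep_L2 (position_op (\<Phi> + \<Psi>)) x = rep_L2 (position_op \<Phi> + position_op \<Psi>) x"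
        by eventually_elim (simp add: algebra_simps)
      thus "position_op (\<Phi> + \<Psi>) = position_op \<Phi> + position_op \<Psi>" by (rule L2_eqI) }
    have "c *\<^sub>C \<Phi> \<in> position_dom" using sub \<Phi> by (simp add: csubspace_def)
    from AE_rep_position_op[OF this] AE_rep_position_op[OF \<Phi>]
      AE_rep_scaleC[of c \<Phi>] AE_rep_scaleC[of c "position_op \<Phi>"]
    have "AE x in lborel. rep_L2 (position_op (c *\<^sub>C \<Phi>)) x = rep_L2 (c *\<^sub>C position_op \<Phi>) x"
      by eventually_elim simp
    thus "position_op (c *\<^sub>C \<Phi>) = c *\<^sub>C position_op \<Phi>" by (rule L2_eqI)
  qed
qed

lemma position_op_L2_on:
  assumes "\<Phi> \<in> L2_on A" "\<Phi> \<in> position_dom"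
  shows "position_op \<Phi> \<in> L2_on A"
  using assms(1) AE_rep_position_op[OF assms(2)] unfolding L2_on_def mem_Collect_eq
  by eventually_elim auto

text \<open>Density inside \<open>L2_on A\<close> is inherited from the whole space: restricting an
  approximant to \<open>A\<close> does not increase its distance to an element of
  \<open>L2_on A\<close>, and it stays in the operator domain for every Borel set, even if
  continuity is lost.\<close>

lemma selfadjoint_position_op:
  assumes A: "A \<in> sets borel"
  shows "selfadjoint (L2_on A) (L2_on A \<inter> position_dom) position_op"
proof -
  let ?D = "L2_on A \<inter> position_dom"
  have "csubspace ?D"
    unfolding position_dom_eq
    by (intro csubspace_Int closed_csubspace_L2_on csubspace_weighted_domain A) auto
  moreover have "L2_on A \<subseteq> closure ?D"
  proof
    fix \<Phi> assume \<Phi>: "\<Phi> \<in> L2_on A"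
    have "\<exists>\<Psi>\<in>?D. dist \<Psi> \<Phi> < e" if "e > 0" for e
    proof -
      have "\<Phi> \<in> closure pc_domain" by (simp add: closure_pc_domain)
      then obtain \<Psi> where \<Psi>: "\<Psi> \<in> pc_domain" "dist \<Psi> \<Phi> < e"
        using \<open>e > 0\<close> by (auto simp: closure_approachable)
      have "\<Psi> \<in> position_dom"
        unfolding position_dom_eq using \<Psi>(1)
        by (rule pc_domain_weighted_domain) (intro continuous_intros)
      hence "restrict_L2 A \<Psi> \<in> position_dom"
        unfolding position_dom_eq by (rule restrict_L2_weighted_domain) (use A in auto)
      moreover have "norm (restrict_L2 A \<Psi> - \<Phi>) \<le> norm (\<Psi> - \<Phi>)"
        using norm_restrict_L2_le[OF A, of "\<Psi> - \<Phi>"] \<Phi>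
        by (simp add: restrict_L2_minus A mem_L2_on_iff)
      ultimately show ?thesis
        using \<Psi>(2) restrict_L2_mem[OF A, of \<Psi>] by (intro bexI[of _ "restrict_L2 A \<Psi>"]) (auto simp: dist_norm)
    qed
    thus "\<Phi> \<in> closure ?D" by (auto simp: closure_approachable)
  qed
  moreover have "position_op ` ?D \<subseteq> L2_on A" using position_op_L2_on by auto
  moreover have "clinear_on ?D position_op"
    using clinear_on_position_op by (simp add: clinear_on_def)
  moreover have "adjoint_graph (L2_on A) ?D position_op = (\<lambda>\<Phi>. (\<Phi>, position_op \<Phi>)) ` ?D"
  proof (intro equalityI subsetI)
    fix p assume "p \<in> adjoint_graph (L2_on A) ?D position_op"
    then obtain \<Psi> \<eta> where p: "p = (\<Psi>, \<eta>)" "\<Psi> \<in> L2_on A" "\<eta> \<in> L2_on A"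
      "\<And>\<Phi>. \<Phi> \<in> ?D \<Longrightarrow> cinner \<Psi> (position_op \<Phi>) = cinner \<eta> \<Phi>"
      unfolding adjoint_graph_def by blast
    from adjoint_position_op[OF A p(2-4)] show "p \<in> (\<lambda>\<Phi>. (\<Phi>, position_op \<Phi>)) ` ?D"
      using p by auto
  next
    fix p assume "p \<in> (\<lambda>\<Phi>. (\<Phi>, position_op \<Phi>)) ` ?D"
    thus "p \<in> adjoint_graph (L2_on A) ?D position_op"
      unfolding adjoint_graph_def using position_op_L2_on position_op_symmetric by blast
  qed
  ultimately show ?thesis unfolding selfadjoint_def by blast
qed

text \<open>Reconciles the form domain, defined with |x|, with the spectral norm, which carries 1 +
  |x|; the difference |\<Phi>|^2 is always integrable.\<close>

lemma one_plus_abs_weighted_domain: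
  "weighted_domain (\<lambda>x. 1 + \<bar>x\<bar>) = weighted_domain (\<lambda>x. \<bar>x\<bar>)"
proof -
  have "integrable lborel (\<lambda>x. (1 + \<bar>x\<bar>) * (cmod (rep_L2 \<Phi> x))\<^sup>2)
      \<longleftrightarrow> integrable lborel (\<lambda>x. \<bar>x\<bar> * (cmod (rep_L2 \<Phi> x))\<^sup>2)" for \<Phi>
    using Bochner_Integration.integrable_add[OF integrable_rep_sq[of \<Phi>], of "\<lambda>x. \<bar>x\<bar> * (cmod (rep_L2 \<Phi> x))\<^sup>2"]
      Bochner_Integration.integrable_diff[OF _ integrable_rep_sq[of \<Phi>], of "\<lambda>x. (1 + \<bar>x\<bar>) * (cmod (rep_L2 \<Phi> x))\<^sup>2"]
    by (auto simp: algebra_simps)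
  thus ?thesis by (simp add: weighted_domain_def)
qed

text \<open>The error of the restricted approximant is the restriction of the original error,
  because \<Phi> is its own restriction to \<open>A\<close>. The nonnegative weight then makes it no
  larger.\<close>

lemma pc_domain_spectral_dense:
  assumes A: "A \<in> sets borel" and \<Phi>: "\<Phi> \<in> L2_on A" "\<Phi> \<in> weighted_domain (\<lambda>x. \<bar>x\<bar>)" and "\<epsilon> > 0"
  shows "\<exists>\<Psi>\<in>restrict_L2 A ` pc_domain. spectral_norm restrict_L2 (\<Phi> - \<Psi>) < \<epsilon>"
proof -
  let ?w = "\<lambda>x::real. 1 + \<bar>x\<bar>"
  have norm_eq: "spectral_norm restrict_L2 \<Xi> = sqrt (LINT x|lborel. ?w x * (cmod (rep_L2 \<Xi> x))\<^sup>2)" for \<Xi>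
    unfolding spectral_norm_def by (subst integral_spectral_measure_restrict_L2) auto
  have \<Phi>w: "\<Phi> \<in> weighted_domain ?w" using \<Phi>(2) by (simp add: one_plus_abs_weighted_domain)
  then obtain \<Psi> where \<Psi>: "\<Psi> \<in> pc_domain"
    "(LINT x|lborel. ?w x * (cmod (rep_L2 (\<Phi> - \<Psi>) x))\<^sup>2) < \<epsilon>\<^sup>2"
    by (rule pc_domain_dense[of _ _ "\<epsilon>\<^sup>2"]) (use \<open>\<epsilon> > 0\<close> in \<open>auto intro!: continuous_intros\<close>)
  have "\<Psi> \<in> weighted_domain ?w"
    using \<Psi>(1) by (rule pc_domain_weighted_domain) (intro continuous_intros)
  moreover have sub: "csubspace (weighted_domain ?w)" by (rule csubspace_weighted_domain) auto
  ultimately have diff: "\<Phi> - \<Psi> \<in> weighted_domain ?w" using \<Phi>w by (intro csubspace_diff)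
  have "\<Phi> - restrict_L2 A \<Psi> = restrict_L2 A (\<Phi> - \<Psi>)"
    using \<Phi>(1) by (simp add: restrict_L2_minus A mem_L2_on_iff)
  hence "(LINT x|lborel. ?w x * (cmod (rep_L2 (\<Phi> - restrict_L2 A \<Psi>) x))\<^sup>2)
      = (LINT x|lborel. ?w x * (cmod (rep_L2 (restrict_L2 A (\<Phi> - \<Psi>)) x))\<^sup>2)" by simp
  also have "\<dots> \<le> (LINT x|lborel. ?w x * (cmod (rep_L2 (\<Phi> - \<Psi>) x))\<^sup>2)"
  proof (rule integral_mono_AE')
    show "integrable lborel (\<lambda>x. ?w x * (cmod (rep_L2 (\<Phi> - \<Psi>) x))\<^sup>2)"
      using diff by (simp add: weighted_domain_def)
    show "AE x in lborel. ?w x * (cmod (rep_L2 (restrict_L2 A (\<Phi> - \<Psi>)) x))\<^sup>2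
        \<le> ?w x * (cmod (rep_L2 (\<Phi> - \<Psi>) x))\<^sup>2"
      using AE_rep_restrict[OF A, of "\<Phi> - \<Psi>"]
      by eventually_elim (auto intro!: mult_left_mono split: split_indicator)
  qed auto
  also note \<Psi>(2)
  finally have "spectral_norm restrict_L2 (\<Phi> - restrict_L2 A \<Psi>) < sqrt (\<epsilon>\<^sup>2)"
    unfolding norm_eq by (rule real_sqrt_less_mono)
  thus ?thesis using \<Psi>(1) \<open>\<epsilon> > 0\<close> by auto
qed

text \<open>The extension is the position form on the full form domain, all of which lies in the
  spectral closure of the core. Prescribing \<open>q\<close> only by its values on the core lets the
  lemma serve both \<open>cell_quad k\<close> and the global form.\<close>

lemma strongly_representable_position_op:
  assumes A: "A \<in> sets borel" and sub: "restrict_L2 A ` pc_domain \<subseteq> pc_domain"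
    and q: "\<And>\<Phi>. \<Phi> \<in> restrict_L2 A ` pc_domain \<Longrightarrow> q \<Phi> = position_quad \<Phi>"
  shows "strongly_representable (L2_on A) (restrict_L2 A ` pc_domain) q
    (L2_on A \<inter> position_dom) position_op"
proof -
  let ?D = "restrict_L2 A ` pc_domain" and ?W = "weighted_domain (\<lambda>x. \<bar>x\<bar>)"
  let ?D' = "L2_on A \<inter> ?W"
  \<comment> \<open>As an intersection, the restricted core is visibly a subspace.\<close>
  have D_eq: "?D = L2_on A \<inter> pc_domain"
  proof (intro equalityI subsetI)
    fix \<Phi> assume "\<Phi> \<in> L2_on A \<inter> pc_domain"
    thus "\<Phi> \<in> ?D" using mem_L2_on_iff[OF A, of \<Phi>] by (metis IntD1 IntD2 imageI)
  qed (use sub restrict_L2_mem[OF A] in auto)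
  have pcW: "pc_domain \<subseteq> ?W"
    by (auto intro!: pc_domain_weighted_domain continuous_intros)
  have subD': "csubspace ?D'"
    by (intro csubspace_Int closed_csubspace_L2_on csubspace_weighted_domain A) auto
  have "csubspace ?D" unfolding D_eq
    by (intro csubspace_Int closed_csubspace_L2_on csubspace_pc_domain A)
  hence "hermitian_form ?D position_form"
    by (rule hermitian_form_position_form) (use sub pcW in auto)
  hence "hermitian_quadratic_form ?D q"
    using q by (auto simp: hermitian_quadratic_form_def position_quad_def)
  moreover have "form_extends (L2_on A) ?D' position_quad ?D q"
  proof -
    have "hermitian_form ?D' position_form"
      by (rule hermitian_form_position_form[OF subD']) auto
    hence "hermitian_quadratic_form ?D' position_quad"
      by (auto simp: hermitian_quadratic_form_def position_quad_def)
    thus ?thesis unfolding form_extends_def using q D_eq pcW by auto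
  qed
  moreover have "?D' = {\<Phi> \<in> spectral_form_domain (L2_on A) restrict_L2.
      \<forall>\<epsilon>>0. \<exists>\<Psi>\<in>?D. spectral_norm restrict_L2 (\<Phi> - \<Psi>) < \<epsilon>}"
    unfolding spectral_form_domain_restrict_L2 using pc_domain_spectral_dense[OF A] by auto
  moreover have "\<forall>\<Phi>\<in>?D'. position_quad \<Phi>
      = complex_of_real (LINT l|spectral_measure restrict_L2 \<Phi>. l)"
    by (simp add: integral_spectral_measure_restrict_L2 position_quad_eq)
  moreover have "L2_on A \<inter> position_dom \<subseteq> ?D'" using position_dom_subset by auto
  moreover have "?D \<subseteq> spectral_form_domain (L2_on A) restrict_L2"
    unfolding spectral_form_domain_restrict_L2 D_eq using pcW by auto
  ultimately show ?thesis
    unfolding strongly_representable_def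
    using selfadjoint_position_op[OF A] is_resolution_of_position_op[OF A] by blast
qed

section \<open>The decomposition into unit cells\<close>

text \<open>Fubini for Lebesgue measure times counting measure, applied to f cut to the k-th cell.
  For fixed x only k equal to the floor of x contributes, so summing over k returns f x.\<close>

lemma
  fixes f :: "real \<Rightarrow> 'b::{banach, second_countable_topology}"
  assumes f: "integrable lborel f"
  shows integrable_cells: "integrable (count_space UNIV) (\<lambda>k. LINT x:unit_cell k|lborel. f x)"
    and integral_cells: "(LINT k|count_space UNIV. (LINT x:unit_cell k|lborel. f x)) = (LINT x|lborel. f x)"
proof -
  interpret sigma_finite_measure "count_space (UNIV :: int set)"
    by (rule sigma_finite_measure_count_space)
  interpret P: pair_sigma_finite lborel "count_space (UNIV :: int set)" ..
  have [measurable]: "f \<in> borel_measurable borel" using f by auto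
  define h where "h = (\<lambda>(x, k). indicator (unit_cell k) x *\<^sub>R f x)"
  \<comment> \<open>Kept polymorphic in the value type, since it is applied to \<open>f x\<close>
    and to \<open>norm (f x)\<close>.\<close>
  have cell: "has_bochner_integral (count_space UNIV) (\<lambda>k. indicator (unit_cell k) x *\<^sub>R c) c"
    for x and c :: "'c::{banach, second_countable_topology}"
  proof -
    have "has_bochner_integral (count_space UNIV) (\<lambda>k. indicator {\<lfloor>x\<rfloor>} k *\<^sub>R c)
        (measure (count_space UNIV) {\<lfloor>x\<rfloor>} *\<^sub>R c)"
      by (rule has_bochner_integral_indicator) auto
    moreover have "indicator (unit_cell k) x = (indicator {\<lfloor>x\<rfloor>} k :: real)" for k
      by (auto simp: mem_unit_cell_iff indicator_def)
    ultimately show ?thesis by (simp add: measure_count_space)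
  qed
  have "integrable (lborel \<Otimes>\<^sub>M count_space UNIV) h"
  proof (rule P.Fubini_integrable)
    have "(\<lambda>p. (\<lambda>k p. indicator (unit_cell k) (fst p) *\<^sub>R f (fst p)) (snd p) p)
        \<in> borel_measurable (lborel \<Otimes>\<^sub>M count_space (UNIV :: int set))"
      by (rule measurable_compose_countable) measurable
    thus "h \<in> borel_measurable (lborel \<Otimes>\<^sub>M count_space UNIV)"
      by (simp add: h_def split_def)
    have "norm (h (x, k)) = indicator (unit_cell k) x *\<^sub>R norm (f x)" for x k
      by (simp add: h_def)
    hence "(\<lambda>x. LINT k|count_space UNIV. norm (h (x, k))) = (\<lambda>x. norm (f x))"
      by (simp only: has_bochner_integral_integral_eq[OF cell])
    thus "integrable lborel (\<lambda>x. LINT k|count_space UNIV. norm (h (x, k)))" using f by simp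
    show "AE x in lborel. integrable (count_space UNIV) (\<lambda>k. h (x, k))"
      unfolding h_def prod.case by (intro AE_I2 integrable.intros[OF cell])
  qed
  hence int: "integrable (lborel \<Otimes>\<^sub>M count_space UNIV) (\<lambda>(x, k). indicator (unit_cell k) x *\<^sub>R f x)"
    by (simp add: h_def)
  show "integrable (count_space UNIV) (\<lambda>k. LINT x:unit_cell k|lborel. f x)"
    using P.integrable_snd[OF int] by (simp add: set_lebesgue_integral_def)
  have "(LINT k|count_space UNIV. (LINT x:unit_cell k|lborel. f x))
      = (LINT x|lborel. LINT k|count_space UNIV. indicator (unit_cell k) x *\<^sub>R f x)"
    using P.Fubini_integral[OF int] by (simp add: set_lebesgue_integral_def)
  also have "\<dots> = (LINT x|lborel. f x)"
    by (simp only: has_bochner_integral_integral_eq[OF cell])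
  finally show "(LINT k|count_space UNIV. (LINT x:unit_cell k|lborel. f x)) = (LINT x|lborel. f x)" .
qed

text \<open>The Tonelli version, for a function whose integrability is still to be proved, as
  happens when sections are glued.\<close>

lemma nn_integral_cells:
  assumes [measurable]: "f \<in> borel_measurable borel"
  shows "(\<integral>\<^sup>+k. (\<integral>\<^sup>+x\<in>unit_cell k. f x \<partial>lborel) \<partial>count_space UNIV) = (\<integral>\<^sup>+x. f x \<partial>lborel)"
proof -
  interpret sigma_finite_measure "count_space (UNIV :: int set)"
    by (rule sigma_finite_measure_count_space)
  interpret P: pair_sigma_finite lborel "count_space (UNIV :: int set)" ..
  have "(\<lambda>p. (\<lambda>k p. f (fst p) * indicator (unit_cell k) (fst p)) (snd p) p)
      \<in> borel_measurable (lborel \<Otimes>\<^sub>M count_space (UNIV :: int set))"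
    by (rule measurable_compose_countable) measurable
  hence "(\<integral>\<^sup>+k. (\<integral>\<^sup>+x. f x * indicator (unit_cell k) x \<partial>lborel) \<partial>count_space UNIV)
      = (\<integral>\<^sup>+x. (\<integral>\<^sup>+k. f x * indicator (unit_cell k) x \<partial>count_space UNIV) \<partial>lborel)"
    using P.Fubini'[of "\<lambda>x k. f x * indicator (unit_cell k) x"] by (simp add: split_def)
  also have "\<dots> = (\<integral>\<^sup>+x. f x \<partial>lborel)"
  proof (intro nn_integral_cong)
    fix x
    have "f x * indicator (unit_cell k) x = f x * indicator {\<lfloor>x\<rfloor>} k" for k
      by (auto simp: mem_unit_cell_iff indicator_def)
    thus "(\<integral>\<^sup>+k. f x * indicator (unit_cell k) x \<partial>count_space UNIV) = f x"
      by (simp add: nn_integral_cmult_indicator)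
  qed
  finally show ?thesis .
qed

lemma cell_proj_single: "cell_proj {k} = restrict_L2 (unit_cell k)"
  by (simp add: cell_proj_def)

lemma cinner_restrict_L2:
  assumes [measurable]: "A \<in> sets borel"
  shows "cinner (restrict_L2 A \<Phi>) (restrict_L2 A \<Psi>)
    = (LINT x:A|lborel. cnj (rep_L2 \<Phi> x) * rep_L2 \<Psi> x)"
  unfolding cinner_L2_def set_lebesgue_integral_def
  by (rule integral_cong_AE, measurable,
      use AE_rep_restrict[OF assms, of \<Phi>] AE_rep_restrict[OF assms, of \<Psi>] in eventually_elim)
    (auto split: split_indicator)

text \<open>Injectivity of the decomposition: the countably many exceptional sets are united, and
  each x is tested in the cell of its own floor.\<close>

lemma L2_eqI_cells:
  assumes "\<And>k. restrict_L2 (unit_cell k) \<Phi> = restrict_L2 (unit_cell k) \<Psi>"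
  shows "\<Phi> = \<Psi>"
proof (rule L2_eqI)
  have "AE x in lborel. \<forall>k. indicator (unit_cell k) x * rep_L2 \<Phi> x = indicator (unit_cell k) x * rep_L2 \<Psi> x"
    unfolding AE_all_countable
  proof
    fix k
    show "AE x in lborel. indicator (unit_cell k) x * rep_L2 \<Phi> x = indicator (unit_cell k) x * rep_L2 \<Psi> x"
      using AE_rep_restrict[OF sets_unit_cell, of k \<Phi>, unfolded assms]
        AE_rep_restrict[OF sets_unit_cell, of k \<Psi>]
      by eventually_elim (rule trans[OF sym])
  qed
  thus "AE x in lborel. rep_L2 \<Phi> x = rep_L2 \<Psi> x"
  proof eventually_elim
    case (elim x)
    from elim[rule_format, of "\<lfloor>x\<rfloor>"] show ?case by (simp add: mem_unit_cell_iff)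
  qed
qed

text \<open>Surjectivity of the decomposition. At x the glued function takes the value of the
  section belonging to the floor of x; measurability follows because the floor has countably many
  values, and square-integrability is the summability of the squared norms.\<close>

lemma glue_cells:
  assumes \<phi>: "\<And>k. \<phi> k \<in> L2_on (unit_cell k)"
    and int: "integrable (count_space UNIV) (\<lambda>k. (norm (\<phi> k))\<^sup>2)"
  shows "\<exists>\<Phi>. \<forall>k. restrict_L2 (unit_cell k) \<Phi> = \<phi> k"
proof -
  define g where "g x = rep_L2 (\<phi> \<lfloor>x\<rfloor>) x" for x
  have [measurable]: "g \<in> borel_measurable borel"
    unfolding g_def by (rule measurable_compose_countable) measurable
  have "(\<integral>\<^sup>+x. ennreal ((cmod (g x))\<^sup>2) \<partial>lborel)
      = (\<integral>\<^sup>+k. (\<integral>\<^sup>+x\<in>unit_cell k. ennreal ((cmod (g x))\<^sup>2) \<partial>lborel) \<partial>count_space UNIV)"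
    by (rule nn_integral_cells [symmetric]) measurable
  also have "\<dots> = (\<integral>\<^sup>+k. ennreal ((norm (\<phi> k))\<^sup>2) \<partial>count_space UNIV)"
  proof (intro nn_integral_cong)
    fix k
    have "(\<integral>\<^sup>+x\<in>unit_cell k. ennreal ((cmod (g x))\<^sup>2) \<partial>lborel)
        = (\<integral>\<^sup>+x\<in>unit_cell k. ennreal ((cmod (rep_L2 (\<phi> k) x))\<^sup>2) \<partial>lborel)"
      by (intro nn_integral_cong) (auto simp: g_def mem_unit_cell_iff split: split_indicator)
    also have "\<dots> = ennreal ((norm (restrict_L2 (unit_cell k) (\<phi> k)))\<^sup>2)"
      by (simp add: norm_restrict_L2_sq_ennreal)
    also have "restrict_L2 (unit_cell k) (\<phi> k) = \<phi> k"
      using \<phi> by (simp add: mem_L2_on_iff[symmetric])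
    finally show "(\<integral>\<^sup>+x\<in>unit_cell k. ennreal ((cmod (g x))\<^sup>2) \<partial>lborel) = ennreal ((norm (\<phi> k))\<^sup>2)" .
  qed
  also have "\<dots> < \<infinity>"
    using int by (simp add: integrable_iff_bounded)
  finally have g: "sq_integrable g"
    by (auto simp: sq_integrable_def intro!: integrableI_nonneg)
  have "restrict_L2 (unit_cell k) (abs_L2 g) = \<phi> k" for k
  proof (rule L2_eqI)
    have "AE x in lborel. x \<notin> unit_cell k \<longrightarrow> rep_L2 (\<phi> k) x = 0" using \<phi>[of k] by (simp add: L2_on_def)
    with AE_rep_restrict[OF sets_unit_cell, of k "abs_L2 g"] AE_rep_abs[OF g]
    show "AE x in lborel. rep_L2 (restrict_L2 (unit_cell k) (abs_L2 g)) x = rep_L2 (\<phi> k) x"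
      by eventually_elim (auto simp: g_def mem_unit_cell_iff split: split_indicator)
  qed
  thus ?thesis by blast
qed

text \<open>Splitting an integral over the cells is used twice: for |\<Phi>|^2 it shows that
  sections are square-integrable, for the product of conj(\<Phi>) and \<Psi> it shows that inner
  products are preserved.\<close>

lemma direct_integral_unitary_cells:
  "direct_integral_unitary (count_space UNIV) (\<lambda>k. L2_on (unit_cell k)) (\<lambda>\<Phi> k. cell_proj {k} \<Phi>)"
  unfolding direct_integral_unitary_def cell_proj_single
proof (intro conjI allI ballI)
  show "bij_betw (\<lambda>\<Phi> k. restrict_L2 (unit_cell k) \<Phi>) UNIV
      (discrete_direct_integral (count_space UNIV) (\<lambda>k. L2_on (unit_cell k)))"
  proof (rule bij_betw_imageI)
    show "inj (\<lambda>\<Phi> k. restrict_L2 (unit_cell k) \<Phi>)"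
      by (rule injI, rule L2_eqI_cells) (rule fun_cong)
    show "range (\<lambda>\<Phi> k. restrict_L2 (unit_cell k) \<Phi>)
        = discrete_direct_integral (count_space UNIV) (\<lambda>k. L2_on (unit_cell k))"
    proof (intro equalityI subsetI)
      fix \<phi> assume "\<phi> \<in> range (\<lambda>\<Phi> k. restrict_L2 (unit_cell k) \<Phi>)"
      thus "\<phi> \<in> discrete_direct_integral (count_space UNIV) (\<lambda>k. L2_on (unit_cell k))"
        using integrable_cells[OF integrable_rep_sq]
        by (auto simp: discrete_direct_integral_def restrict_L2_mem norm_restrict_L2_sq)
    next
      fix \<phi> assume "\<phi> \<in> discrete_direct_integral (count_space UNIV) (\<lambda>k. L2_on (unit_cell k))"
      hence "\<And>k. \<phi> k \<in> L2_on (unit_cell k)" "integrable (count_space UNIV) (\<lambda>k. (norm (\<phi> k))\<^sup>2)"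
        by (auto simp: discrete_direct_integral_def)
      from glue_cells[OF this] obtain \<Phi> where "\<forall>k. restrict_L2 (unit_cell k) \<Phi> = \<phi> k" ..
      thus "\<phi> \<in> range (\<lambda>\<Phi> k. restrict_L2 (unit_cell k) \<Phi>)" by (intro image_eqI[of _ _ \<Phi>]) auto
    qed
  qed
next
  fix k show "clinear_on UNIV (restrict_L2 (unit_cell k))"
    by (simp add: clinear_on_def restrict_L2_add restrict_L2_scaleC)
next
  fix \<Phi> \<Psi>
  show "cinner \<Phi> \<Psi> = (LINT k|count_space UNIV.
      cinner (restrict_L2 (unit_cell k) \<Phi>) (restrict_L2 (unit_cell k) \<Psi>))"
    by (simp add: cinner_restrict_L2 integral_cells integrable_rep_prod) (simp add: cinner_L2_def)
qed

section \<open>Closability of forms given by an operator\<close>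

lemma tendsto_cinner_right:
  assumes "X \<longlonglongrightarrow> (0 :: 'a::complex_inner)"
  shows "(\<lambda>n. cinner a (X n)) \<longlonglongrightarrow> 0"
proof -
  \<comment> \<open>The imaginary part is a real inner product against i a, so continuity of the
    real inner product handles both parts.\<close>
  have "Im (cinner a b) = inner (\<i> *\<^sub>C a) b" for b
    unfolding inner_eq_Re_cinner
    by (subst cinner_commute, subst cinner_scaleC_right, subst cinner_commute) simp
  moreover have "(\<lambda>n. inner c (X n)) \<longlonglongrightarrow> 0" for c
    using tendsto_inner[OF tendsto_const assms, of c] by simp
  ultimately show ?thesis by (simp add: tendsto_complex_iff inner_eq_Re_cinner [symmetric])
qed

text \<open>Positivity of the form is not needed for closability: the cross terms \<open>B (X m) (X n)\<close> vanish as
  \<open>n\<close> tends to infinity, so that \<open>B (X n) (X n) + B (X m) (X m)\<close> is eventually small. Comparing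
  three such sums forces \<open>B (X n) (X n)\<close> itself to be small.\<close>

lemma closable_operator_form:
  assumes B: "hermitian_form D B" and T: "\<And>\<Phi> \<Psi>. \<Phi> \<in> D \<Longrightarrow> \<Psi> \<in> D \<Longrightarrow> B \<Phi> \<Psi> = cinner (T \<Phi>) \<Psi>"
  shows "closable D (\<lambda>\<Phi>. B \<Phi> \<Phi>)"
  unfolding closable_def
proof (intro allI impI)
  fix X :: "nat \<Rightarrow> 'a"
  assume "range X \<subseteq> D" and X0: "X \<longlonglongrightarrow> 0"
    and cauchy: "((\<lambda>(n, m). B (X n - X m) (X n - X m)) \<longlongrightarrow> 0) (sequentially \<times>\<^sub>F sequentially)"
  hence XD: "X n \<in> D" for n by auto
  have D: "csubspace D" using B by (simp add: hermitian_form_def)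
  have Bcom: "B \<Psi> \<Phi> = cnj (B \<Phi> \<Psi>)" if "\<Phi> \<in> D" "\<Psi> \<in> D" for \<Phi> \<Psi>
    using B that unfolding hermitian_form_def by blast
  have Badd: "B \<Phi> (\<Psi> + \<Xi>) = B \<Phi> \<Psi> + B \<Phi> \<Xi>" "B (\<Phi> + \<Psi>) \<Xi> = B \<Phi> \<Xi> + B \<Psi> \<Xi>"
    if "\<Phi> \<in> D" "\<Psi> \<in> D" "\<Xi> \<in> D" for \<Phi> \<Psi> \<Xi>
    using B that unfolding hermitian_form_def by blast+
  define q where "q n = B (X n) (X n)" for n
  define c where "c m n = B (X m) (X n) + B (X n) (X m)" for m n
  have diff: "q n + q m = B (X n - X m) (X n - X m) + c m n" for m n
  proof -
    have d: "X n - X m \<in> D" by (intro csubspace_diff D XD)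
    have "B (X n) \<Psi> = B (X n - X m) \<Psi> + B (X m) \<Psi>" if "\<Psi> \<in> D" for \<Psi>
      using Badd(2)[OF d XD[of m] that] by simp
    moreover have "B \<Psi> (X n) = B \<Psi> (X n - X m) + B \<Psi> (X m)" if "\<Psi> \<in> D" for \<Psi>
      using Badd(1)[OF that d XD[of m]] by simp
    ultimately show ?thesis
      unfolding q_def c_def using XD d by simp
  qed
  have cross: "c m \<longlonglongrightarrow> 0" for m
  proof -
    \<comment> \<open>Here the operator enters: with m fixed, \<open>T (X m)\<close> is a fixed
      vector paired with a null sequence.\<close>
    have "(\<lambda>n. B (X m) (X n)) \<longlonglongrightarrow> 0"
      using tendsto_cinner_right[OF X0] by (simp add: T XD)
    from tendsto_add[OF this tendsto_cnj[OF this]]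
    show ?thesis by (simp add: c_def [abs_def] Bcom[OF XD XD, symmetric])
  qed
  show "(\<lambda>n. B (X n) (X n)) \<longlonglongrightarrow> 0"
  proof (rule LIMSEQ_I)
    fix r :: real assume r: "r > 0"
    \<comment> \<open>Three sums, each below 2 e, bound |2 q n|; thus |q n| < 3 e = r.\<close>
    define e where "e = r / 3"
    have e: "e > 0" using r by (simp add: e_def)
    have "\<forall>\<^sub>F p in sequentially \<times>\<^sub>F sequentially. dist (case p of (n, m) \<Rightarrow> B (X n - X m) (X n - X m)) 0 < e"
      using tendstoD[OF cauchy e] .
    then obtain N where N: "\<And>n m. n \<ge> N \<Longrightarrow> m \<ge> N \<Longrightarrow> cmod (B (X n - X m) (X n - X m)) < e"
      unfolding eventually_prod_sequentially by auto
    have "\<exists>K\<ge>N. \<forall>n\<ge>K. cmod (q n + q m) < 2 * e" if "m \<ge> N" for m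
    proof -
      obtain K where K: "\<And>n. n \<ge> K \<Longrightarrow> cmod (c m n) < e"
        using LIMSEQ_D[OF cross e] by auto
      have "cmod (q n + q m) < 2 * e" if "n \<ge> max K N" for n
        using N[of n m] K[of n] that \<open>m \<ge> N\<close> norm_triangle_ineq[of "B (X n - X m) (X n - X m)" "c m n"]
        by (simp add: diff)
      thus ?thesis by (intro exI[of _ "max K N"]) auto
    qed
    then obtain K where K: "\<And>m. m \<ge> N \<Longrightarrow> K m \<ge> N"
      "\<And>m n. m \<ge> N \<Longrightarrow> n \<ge> K m \<Longrightarrow> cmod (q n + q m) < 2 * e"
      by metis
    have "cmod (q n) < r" if n: "n \<ge> K N" for n
    proof -
      \<comment> \<open>An index late enough to be paired with \<open>N\<close> and with
        \<open>n\<close>, whose thresholds are \<open>K N\<close> and \<open>K n\<close>.\<close>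
      define l where "l = max (K N) (K n)"
      have nN: "n \<ge> N" using K(1)[of N] n by simp
      have "2 * q n = (q l + q n) + (q n + q N) - (q l + q N)" by simp
      hence "cmod (2 * q n) \<le> cmod (q l + q n) + cmod (q n + q N) + cmod (q l + q N)"
        by (metis norm_triangle_le_diff norm_triangle_ineq add_mono order_refl)
      also have "\<dots> < 2 * e + 2 * e + 2 * e"
        by (intro add_strict_mono K nN n) (auto simp: l_def)
      finally show ?thesis by (simp add: norm_mult e_def)
    qed
    thus "\<exists>no. \<forall>n\<ge>no. norm (B (X n) (X n) - 0) < r" by (auto simp: q_def)
  qed
qed

lemma pc_domain_position_dom: "pc_domain \<subseteq> position_dom"
  unfolding position_dom_eq by (auto intro!: pc_domain_weighted_domain continuous_intros)

lemma hermitian_form_pc_domain: "hermitian_form pc_domain position_form"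
  using csubspace_pc_domain pc_domain_position_dom position_dom_subset
  by (intro hermitian_form_position_form) auto

lemma position_form_eq_cinner:
  assumes "\<Phi> \<in> position_dom"
  shows "position_form \<Phi> \<Psi> = cinner (position_op \<Phi>) \<Psi>"
  unfolding position_form_def cinner_L2_def
  by (rule integral_cong_AE, measurable, use AE_rep_position_op[OF assms] in eventually_elim) simp

lemma closable_position_quad: "closable pc_domain position_quad"
proof -
  have "closable pc_domain (\<lambda>\<Phi>. position_form \<Phi> \<Phi>)"
    using pc_domain_position_dom
    by (intro closable_operator_form[OF hermitian_form_pc_domain, where T = position_op]
        position_form_eq_cinner) auto
  thus ?thesis by (simp add: position_quad_def [abs_def])
qed

section \<open>Orthogonal additivity and the counting measure\<close>

lemma position_quad_cell_proj:
  "position_quad (cell_proj \<Delta> \<Phi>)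
    = complex_of_real (LINT x|lborel. indicator \<Delta> \<lfloor>x\<rfloor> * (x * (cmod (rep_L2 \<Phi> x))\<^sup>2))"
proof -
  have "(LINT x|lborel. x * (cmod (rep_L2 (cell_proj \<Delta> \<Phi>) x))\<^sup>2)
      = (LINT x|lborel. indicator (\<Union>k\<in>\<Delta>. unit_cell k) x * (x * (cmod (rep_L2 \<Phi> x))\<^sup>2))"
    unfolding cell_proj_def
    by (rule integral_cong_AE, measurable, use AE_rep_restrict[OF sets_cells, of \<Delta> \<Phi>] in eventually_elim)
      (auto split: split_indicator)
  thus ?thesis unfolding position_quad_eq by (simp add: indicator_cells)
qed

text \<open>With a projection written as the factor
  \<open>indicator \<Delta> \<lfloor>x\<rfloor>\<close>, additivity over a finite partition is
  additivity of indicators under the integral, and every form value is dominated by the integral of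
  |x| |\<Phi>|^2, uniformly in \<open>\<Delta>\<close>.\<close>

lemma orthogonally_additive_position_quad: "orthogonally_additive cell_proj pc_domain position_quad"
  unfolding orthogonally_additive_def
proof (intro conjI allI impI ballI)
  show "cell_proj \<Delta> ` pc_domain \<subseteq> pc_domain" for \<Delta>
    using cell_proj_pc_domain by auto
  have meas [measurable]: "(\<lambda>x::real. indicator \<Delta> \<lfloor>x\<rfloor> :: real) \<in> borel_measurable borel" for \<Delta>
    by (rule measurable_compose[OF measurable_real_floor]) auto
  have int: "integrable lborel (\<lambda>x. \<bar>x\<bar> * (cmod (rep_L2 \<Phi> x))\<^sup>2)" if "\<Phi> \<in> pc_domain" for \<Phi>
    using that pc_domain_position_dom position_dom_subset by (auto simp: weighted_domain_def)
  have le: "norm (indicator \<Delta> \<lfloor>x\<rfloor> * (x * (cmod z)\<^sup>2)) \<le> \<bar>x\<bar> * (cmod z)\<^sup>2" for \<Delta> x z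
    by (auto simp: abs_mult split: split_indicator)
  have int': "integrable lborel (\<lambda>x. indicator \<Delta> \<lfloor>x\<rfloor> * (x * (cmod (rep_L2 \<Phi> x))\<^sup>2))"
    if "\<Phi> \<in> pc_domain" for \<Phi> \<Delta>
  proof (rule Bochner_Integration.integrable_bound[OF int[OF that]])
    show "AE x in lborel. norm (indicator \<Delta> \<lfloor>x\<rfloor> * (x * (cmod (rep_L2 \<Phi> x))\<^sup>2))
        \<le> norm (\<bar>x\<bar> * (cmod (rep_L2 \<Phi> x))\<^sup>2)"
      using le by (intro AE_I2) (simp add: abs_mult)
  qed measurable
  fix \<Phi> assume \<Phi>: "\<Phi> \<in> pc_domain"
  show "\<exists>M>0. \<forall>\<Delta>. cmod (position_quad (cell_proj \<Delta> \<Phi>)) < M"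
  proof (intro exI conjI allI)
    let ?M = "LINT x|lborel. \<bar>x\<bar> * (cmod (rep_L2 \<Phi> x))\<^sup>2"
    have "?M \<ge> 0" by (rule integral_nonneg_AE) simp
    \<comment> \<open>Adding 1 makes the bound strict and positive even if the integral is
      zero.\<close>
    thus "?M + 1 > 0" by linarith
    fix \<Delta>
    have "norm (LINT x|lborel. indicator \<Delta> \<lfloor>x\<rfloor> * (x * (cmod (rep_L2 \<Phi> x))\<^sup>2)) \<le> ?M"
      by (rule Bochner_Integration.integral_norm_bound_integral[OF int'[OF \<Phi>] int[OF \<Phi>]]) (rule le)
    thus "cmod (position_quad (cell_proj \<Delta> \<Phi>)) < ?M + 1"
      by (simp add: position_quad_cell_proj)
  qed
  fix \<Delta> :: "int set" and \<P> assume fin: "finite \<P>" and part: "partition_on \<Delta> \<P>"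
  have "indicator \<Delta> k = (\<Sum>\<Gamma>\<in>\<P>. indicator \<Gamma> k :: real)" for k
    using indicator_UN_disjoint[OF fin, of "\<lambda>\<Gamma>. \<Gamma>" k] part
    by (auto simp: partition_on_def disjoint_def disjoint_family_on_def)
  hence "(LINT x|lborel. indicator \<Delta> \<lfloor>x\<rfloor> * (x * (cmod (rep_L2 \<Phi> x))\<^sup>2))
      = (LINT x|lborel. (\<Sum>\<Gamma>\<in>\<P>. indicator \<Gamma> \<lfloor>x\<rfloor> * (x * (cmod (rep_L2 \<Phi> x))\<^sup>2)))"
    by (simp add: sum_distrib_right)
  also have "\<dots> = (\<Sum>\<Gamma>\<in>\<P>. LINT x|lborel. indicator \<Gamma> \<lfloor>x\<rfloor> * (x * (cmod (rep_L2 \<Phi> x))\<^sup>2))"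
    by (rule Bochner_Integration.integral_sum) (rule int'[OF \<Phi>])
  finally show "position_quad (cell_proj \<Delta> \<Phi>) = (\<Sum>\<Gamma>\<in>\<P>. position_quad (cell_proj \<Gamma> \<Phi>))"
    by (simp add: position_quad_cell_proj)
qed

text \<open>For infinite \<open>\<Delta>\<close> a sum of ones is infinite in the extended
  nonnegative reals, as is the counting measure; for finite \<open>\<Delta>\<close> both are the
  cardinality.\<close>

lemma point_supported_count_space:
  assumes "countable A"
  shows "point_supported (count_space A)"
  unfolding point_supported_def
proof (intro conjI allI impI)
  fix \<Delta> assume "\<Delta> \<subseteq> space (count_space A)"
  hence \<Delta>: "\<Delta> \<subseteq> A" by simp
  have "(\<Sum>\<^sub>\<infinity>x\<in>\<Delta>. emeasure (count_space A) {x}) = (\<Sum>\<^sub>\<infinity>x\<in>\<Delta>. 1)"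
    using \<Delta> by (intro infsum_cong) (auto simp: emeasure_count_space)
  also have "\<dots> = emeasure (count_space A) \<Delta>"
  proof (cases "finite \<Delta>")
    case False
    thus ?thesis
      using \<Delta> infsum_superconst_infinite_ennreal[of \<Delta> 1 "\<lambda>x. 1"] by (simp add: emeasure_count_space)
  qed (use \<Delta> in \<open>simp add: emeasure_count_space\<close>)
  finally show "emeasure (count_space A) \<Delta> = (\<Sum>\<^sub>\<infinity>x\<in>\<Delta>. emeasure (count_space A) {x})" by simp
qed (use assms in auto)

theorem theorem5p2:
  shows "direct_integral_unitary (count_space UNIV) (\<lambda>k. L2_on (unit_cell k))
      (\<lambda>\<Phi> k. cell_proj {k} \<Phi>)
    \<and> csubspace pc_domain \<and> closure pc_domain = UNIV
    \<and> hermitian_form pc_domain position_form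
    \<and> selfadjoint UNIV position_dom position_op
    \<and> pc_domain \<subseteq> sqrt_abs_domain UNIV position_dom position_op
    \<and> (closable pc_domain position_quad
        \<and> orthogonally_additive cell_proj pc_domain position_quad)
    \<and> (point_supported (count_space (UNIV :: int set))
        \<and> (\<forall>k :: int. emeasure (count_space UNIV) {k} > 0))
    \<and> (\<forall>k. \<exists>DS S.
        strongly_representable (L2_on (unit_cell k)) (cell_proj {k} ` pc_domain) (cell_quad k) DS S)
    \<and> strongly_representable UNIV pc_domain position_quad position_dom position_op"
proof (intro conjI allI)
  show "direct_integral_unitary (count_space UNIV) (\<lambda>k. L2_on (unit_cell k)) (\<lambda>\<Phi> k. cell_proj {k} \<Phi>)"
    by (rule direct_integral_unitary_cells)
  show "csubspace pc_domain" "closure pc_domain = UNIV" "hermitian_form pc_domain position_form"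
    by (rule csubspace_pc_domain closure_pc_domain hermitian_form_pc_domain)+
  show "selfadjoint UNIV position_dom position_op"
    using selfadjoint_position_op[of UNIV] by (simp add: L2_on_UNIV)
  have "is_resolution_of UNIV position_dom position_op restrict_L2"
    using is_resolution_of_position_op[of UNIV] by (simp add: L2_on_UNIV)
  moreover have "pc_domain \<subseteq> spectral_form_domain UNIV restrict_L2"
    using pc_domain_position_dom position_dom_subset by (auto simp: spectral_form_domain_restrict_L2)
  ultimately show "pc_domain \<subseteq> sqrt_abs_domain UNIV position_dom position_op"
    unfolding sqrt_abs_domain_def by blast
  show "closable pc_domain position_quad" "orthogonally_additive cell_proj pc_domain position_quad"
    by (rule closable_position_quad orthogonally_additive_position_quad)+
  show "point_supported (count_space (UNIV :: int set))"
    by (rule point_supported_count_space) simp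
  show "emeasure (count_space UNIV) {k} > 0" for k :: int
    by (simp add: emeasure_count_space)
  show "\<exists>DS S. strongly_representable (L2_on (unit_cell k)) (cell_proj {k} ` pc_domain) (cell_quad k) DS S" for k
  proof (intro exI)
    \<comment> \<open>The witness is the part of T in the cell. As x is bounded there, its domain is
      in fact all of \<open>L2_on (unit_cell k)\<close>.\<close>
    show "strongly_representable (L2_on (unit_cell k)) (cell_proj {k} ` pc_domain) (cell_quad k)
        (L2_on (unit_cell k) \<inter> position_dom) position_op"
      unfolding cell_proj_single
      by (rule strongly_representable_position_op)
        (use cell_proj_pc_domain[of _ "{k}"] cell_quad_cell_proj(1)[of k] in \<open>auto simp: cell_proj_single\<close>)
  qed
  have "restrict_L2 UNIV ` pc_domain = pc_domain" by (simp add: restrict_L2_UNIV)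
  thus "strongly_representable UNIV pc_domain position_quad position_dom position_op"
    using strongly_representable_position_op[of UNIV position_quad] by (simp add: L2_on_UNIV)
qed

end
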